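(* Let $(X,\rho,|\cdot|)$ be a homogeneous space. There is a constant $\beta$ depending only on $X$ such that for all $1\le j\le J$, all $k\in\{1,2,\dots\}$, every operator $B=B_{j,k}$ (built from a cube $Q_0$) of the form described in the context, every weight $\omega\in A_2$, every $f\in L^2(\omega)$, and every $Q_2\in S^j$ with $$\operatorname{diam}(Q_2)>D\cdot2^kC\delta^{k(Q_0)},$$ one has $$\|m(B^*f,Q_2)\|_{L^2(\omega,Q_2)}\le\beta\,k\,\|f\|_{L^2(\omega,Q_2)}\,[\omega]_{A_2},$$ where on the left $m(B^*f,Q_2)$ is regarded as a constant function on $Q_2$.
   Context: Homogeneous space: $(X,\rho,|\cdot|)$ with $\rho$ a quasimetric ($\rho(x,y)=0$ iff $x=y$; symmetric; $\rho(x,z)\le C_0(\rho(x,y)+\rho(y,z))$) and $|\cdot|$ a positive (Borel) doubling measure: $0<|B(x,2r)|\le C_d|B(x,r)|<\infty$ for all $x\in X$, $r>0$, where $B(x,r)$ are the $\rho$-balls. Weight: a nonnegative locally integrable function $\omega$ on $X$; $\omega\in A_2$ means $[\omega]_{A_2}:=\sup_{x\in X,r>0}\big(\frac1{|B(x,r)|}\int_{B(x,r)}\omega\big)\big(\frac1{|B(x,r)|}\int_{B(x,r)}\omega^{-1}\big)<\infty$. $\|f\|_{L^2(\omega,Q)}^2=\int_Q|f|^2\omega$ and $L^2(\omega)=L^2(\omega,X)$. Dyadic decomposition of $X$ with constants $C>0$, $\delta\in(0,1)$, $\epsilon\in(0,1)$ (depending only on $X$): a family of measurable sets $S=\bigcup_{i\in\mathbb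 Z}S_i$ with points $x_c(Q)$ ($Q\in S$) such that: (1) $|X\setminus\bigcup_{Q\in S_i}Q|=0$ for all $i$; (2) if $Q_1,Q_2\in S$ then either $Q_1\cap Q_2=\emptyset$ or one is contained in the other; (3) for every $Q_1\in S_i$ there is at least one $Q_2\in S_{i+1}$ with $Q_2\subset Q_1$ (a child) and exactly one $Q_3\in S_{i-1}$ with $Q_1\subset Q_3$ (the parent); (4) if $Q_2$ is a child of $Q_1$ then $|Q_2|\ge\epsilon|Q_1|$; (5) $B(x_c(Q),\delta^i)\subset Q\subset B(x_c(Q),C\delta^i)$ for $Q\in S_i$. For $Q\in S$, $k(Q)$ is the integer with $Q\in S_{k(Q)}$, and $2^kQ:=B(x_c(Q),2^kC\delta^{k(Q)})$. Sparse family: for $Q_0\in S$, $S(Q_0)$ is sparse in $Q_0$ with respect to $S$ if $S(Q_0)=\bigcup_{n\ge0}C_n$ where each element of $S(Q_0)$ belongs to $S$ and is a subset of $Q_0$; the elements of each $C_n$ are pairwise disjoint; $C_0=\{Q_0\}$; for $n>0$ each $Q\in C_n$ is a subset of an element of $C_{n-1}$; and $\big|\bigcup_{Q\in C_{n+1}}Q\cap Q_1\big|\le|Q_1|/2$ for every $Q_1\in C_n$. Adjacent dyadic systems: fixed are $J\in\mathbb N$ and $D>0$ depending only on $X$ and dyadic decompositions $S^1,\dots,S^J$ of $X$ (with the constants $C,\delta,\epsilon$) such that for every ball $B(x,r)$ there are $1\le j\le J$ and $Q\in S^j$ with $B(x,r)\subset Q$ and $\operatorname{diam}(Q)\le Dr$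 (their existence is a known theorem of Hytönen–Kairema). The operators $B_{j,k}$: let $S$ be a dyadic decomposition, $Q_0\in S$, $S(Q_0)$ a sparse family in $Q_0$ with respect to $S$, and let $S'(Q_0)\subset S(Q_0)$ be a subset such that for each $Q\in S'(Q_0)$ there is a chosen set $Q^*\in S^j$ with $2^kQ\subset Q^*$ and $\operatorname{diam}(Q^* )\le D\,2^kC\delta^{k(Q)}$. Then $$B(f)=B_{j,k}(f)=\sum_{Q\in S'(Q_0)}\Big(\frac1{|Q^*|}\int_{Q^*}f\Big)\chi_Q,\qquad B^*(f)=\sum_{Q\in S'(Q_0)}\Big(\frac1{|Q^*|}\int_{Q}f\Big)\chi_{Q^*}.$$ For a set $Q$ with $0<|Q|<\infty$ and measurable $g$, the median of $g$ on $Q$ is $m(g,Q)=\sup\{a\in\mathbb R:\ |\{x\in Q:g(x)<a\}|\le\tfrac12|Q|\}$. *)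

theory Defs
  imports "HOL-Analysis.Analysis"
begin

definition quasimetric :: "('a \<Rightarrow> 'a \<Rightarrow> real) \<Rightarrow> bool" where
  "quasimetric \<rho> \<longleftrightarrow>
     (\<forall>x y. 0 \<le> \<rho> x y) \<and> (\<forall>x y. \<rho> x y = 0 \<longleftrightarrow> x = y) \<and> (\<forall>x y. \<rho> x y = \<rho> y x) \<and>
     (\<exists>C0. \<forall>x y z. \<rho> x z \<le> C0 * (\<rho> x y + \<rho> y z))"

definition qball :: "('a \<Rightarrow> 'a \<Rightarrow> real) \<Rightarrow> 'a \<Rightarrow> real \<Rightarrow> 'a set" where
  "qball \<rho> x r = {y. \<rho> x y < r}"

definition qopen :: "('a \<Rightarrow> 'a \<Rightarrow> real) \<Rightarrow> 'a set \<Rightarrow> bool" where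
  "qopen \<rho> U \<longleftrightarrow> (\<forall>x\<in>U. \<exists>r>0. qball \<rho> x r \<subseteq> U)"

definition qdiam :: "('a \<Rightarrow> 'a \<Rightarrow> real) \<Rightarrow> 'a set \<Rightarrow> real" where
  "qdiam \<rho> Q = Sup {\<rho> x y | x y. x \<in> Q \<and> y \<in> Q}"

text \<open>The space is the whole type. Balls of a quasimetric need not be Borel, so their
  measurability is required separately; the \<open>\<sigma>\<close>-algebra may be larger than the Borel one
  (e.g. its completion).\<close>

definition homogeneous_space :: "'a measure \<Rightarrow> ('a \<Rightarrow> 'a \<Rightarrow> real) \<Rightarrow> bool" where
  "homogeneous_space M \<rho> \<longleftrightarrow>
     quasimetric \<rho> \<and> space M = UNIV \<and>
     (\<forall>U. qopen \<rho> U \<longrightarrow> U \<in> sets M) \<and> (\<forall>x. \<forall>r>0. qball \<rho> x r \<in> sets M) \<and>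
     (\<exists>Cd::real. \<forall>x. \<forall>r>0.
        0 < emeasure M (qball \<rho> x (2 * r)) \<and>
        emeasure M (qball \<rho> x (2 * r)) \<le> ennreal Cd * emeasure M (qball \<rho> x r) \<and>
        emeasure M (qball \<rho> x r) < \<infinity>)"

definition weight :: "'a measure \<Rightarrow> ('a \<Rightarrow> 'a \<Rightarrow> real) \<Rightarrow> ('a \<Rightarrow> real) \<Rightarrow> bool" where
  "weight M \<rho> \<omega> \<longleftrightarrow>
     \<omega> \<in> borel_measurable M \<and> (\<forall>x. 0 \<le> \<omega> x) \<and>
     (\<forall>x. \<forall>r>0. set_integrable M (qball \<rho> x r) \<omega>)"

text \<open>The reciprocal of the weight is taken in \<^typ>\<open>ennreal\<close>, so that it is \<open>\<infinity>\<close> where the weight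
  vanishes.\<close>

definition A2_const :: "'a measure \<Rightarrow> ('a \<Rightarrow> 'a \<Rightarrow> real) \<Rightarrow> ('a \<Rightarrow> real) \<Rightarrow> ennreal" where
  "A2_const M \<rho> \<omega> = (SUP x. SUP r\<in>{0<..}.
     ((\<integral>\<^sup>+y\<in>qball \<rho> x r. ennreal (\<omega> y) \<partial>M) / emeasure M (qball \<rho> x r)) *
     ((\<integral>\<^sup>+y\<in>qball \<rho> x r. inverse (ennreal (\<omega> y)) \<partial>M) / emeasure M (qball \<rho> x r)))"

definition A2_weight :: "'a measure \<Rightarrow> ('a \<Rightarrow> 'a \<Rightarrow> real) \<Rightarrow> ('a \<Rightarrow> real) \<Rightarrow> bool" where
  "A2_weight M \<rho> \<omega> \<longleftrightarrow> weight M \<rho> \<omega> \<and> A2_const M \<rho> \<omega> < \<infinity>"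

definition L2_weighted :: "'a measure \<Rightarrow> ('a \<Rightarrow> real) \<Rightarrow> ('a \<Rightarrow> real) set" where
  "L2_weighted M \<omega> = {f \<in> borel_measurable M. integrable M (\<lambda>x. \<bar>f x\<bar>\<^sup>2 * \<omega> x)}"

definition L2_norm_on :: "'a measure \<Rightarrow> ('a \<Rightarrow> real) \<Rightarrow> 'a set \<Rightarrow> ('a \<Rightarrow> real) \<Rightarrow> real" where
  "L2_norm_on M \<omega> Q f = sqrt (LINT x:Q|M. \<bar>f x\<bar>\<^sup>2 * \<omega> x)"

text \<open>\<open>S i\<close> is the family of cubes of generation \<open>i\<close>. In a bounded space, or at an isolated point,
  one set can be a cube of several generations, so the centre \<open>xc i Q\<close> is that of \<open>Q\<close> as a cube of
  generation \<open>i\<close>.\<close>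

definition dyadic_decomposition ::
  "'a measure \<Rightarrow> ('a \<Rightarrow> 'a \<Rightarrow> real) \<Rightarrow> real \<Rightarrow> real \<Rightarrow> real \<Rightarrow>
   (int \<Rightarrow> 'a set set) \<Rightarrow> (int \<Rightarrow> 'a set \<Rightarrow> 'a) \<Rightarrow> bool" where
  "dyadic_decomposition M \<rho> C \<delta> \<epsilon> S xc \<longleftrightarrow>
     (\<forall>i. S i \<subseteq> sets M) \<and>
     (\<forall>i. space M - \<Union>(S i) \<in> null_sets M) \<and>
     (\<forall>Q1\<in>(\<Union>i. S i). \<forall>Q2\<in>(\<Union>i. S i). Q1 \<inter> Q2 = {} \<or> Q1 \<subseteq> Q2 \<or> Q2 \<subseteq> Q1) \<and>
     (\<forall>i. \<forall>Q1\<in>S i. (\<exists>Q2\<in>S (i + 1). Q2 \<subseteq> Q1) \<and> (\<exists>!Q3. Q3 \<in> S (i - 1) \<and> Q1 \<subseteq> Q3)) \<and>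
     (\<forall>i. \<forall>Q1\<in>S i. \<forall>Q2\<in>S (i + 1). Q2 \<subseteq> Q1 \<longrightarrow> measure M Q2 \<ge> \<epsilon> * measure M Q1) \<and>
     (\<forall>i. \<forall>Q\<in>S i. qball \<rho> (xc i Q) (\<delta> powi i) \<subseteq> Q \<and> Q \<subseteq> qball \<rho> (xc i Q) (C * \<delta> powi i))"

text \<open>A function \<open>Q \<mapsto> k(Q)\<close>; it is unique on cubes unless a set is a cube of several generations.\<close>

definition generation_function :: "(int \<Rightarrow> 'a set set) \<Rightarrow> ('a set \<Rightarrow> int) \<Rightarrow> bool" where
  "generation_function S gen \<longleftrightarrow> (\<forall>Q\<in>(\<Union>i. S i). Q \<in> S (gen Q))"

definition dilated_cube ::
  "('a \<Rightarrow> 'a \<Rightarrow> real) \<Rightarrow> real \<Rightarrow> real \<Rightarrow> (int \<Rightarrow> 'a set \<Rightarrow> 'a) \<Rightarrow> ('a set \<Rightarrow> int) \<Rightarrow> nat \<Rightarrow> 'a set \<Rightarrow> 'a set"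
  where
  "dilated_cube \<rho> C \<delta> xc gen k Q = qball \<rho> (xc (gen Q) Q) (2 ^ k * C * \<delta> powi gen Q)"

definition sparse_family_in ::
  "'a measure \<Rightarrow> (int \<Rightarrow> 'a set set) \<Rightarrow> 'a set \<Rightarrow> 'a set set \<Rightarrow> bool" where
  "sparse_family_in M S Q0 SQ \<longleftrightarrow>
     (\<exists>\<C> :: nat \<Rightarrow> 'a set set.
        SQ = (\<Union>n. \<C> n) \<and>
        (\<forall>Q\<in>SQ. Q \<in> (\<Union>i. S i) \<and> Q \<subseteq> Q0) \<and>
        (\<forall>n. pairwise disjnt (\<C> n)) \<and>
        \<C> 0 = {Q0} \<and>
        (\<forall>n>0. \<forall>Q\<in>\<C> n. \<exists>Q'\<in>\<C> (n - 1). Q \<subseteq> Q') \<and>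
        (\<forall>n. \<forall>Q1\<in>\<C> n. measure M (\<Union>(\<C> (n + 1)) \<inter> Q1) \<le> measure M Q1 / 2))"

definition adjacent_dyadic_systems ::
  "'a measure \<Rightarrow> ('a \<Rightarrow> 'a \<Rightarrow> real) \<Rightarrow> real \<Rightarrow> real \<Rightarrow> real \<Rightarrow> nat \<Rightarrow> real \<Rightarrow>
   (nat \<Rightarrow> int \<Rightarrow> 'a set set) \<Rightarrow> (nat \<Rightarrow> int \<Rightarrow> 'a set \<Rightarrow> 'a) \<Rightarrow> bool" where
  "adjacent_dyadic_systems M \<rho> C \<delta> \<epsilon> J D \<S> xcs \<longleftrightarrow>
     (\<forall>j\<in>{1..J}. dyadic_decomposition M \<rho> C \<delta> \<epsilon> (\<S> j) (xcs j)) \<and>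
     (\<forall>x. \<forall>r>0. \<exists>j\<in>{1..J}. \<exists>Q\<in>(\<Union>i. \<S> j i). qball \<rho> x r \<subseteq> Q \<and> qdiam \<rho> Q \<le> D * r)"

text \<open>The data of an operator \<open>B\<^sub>j\<^sub>,\<^sub>k\<close> built from \<open>Q0\<close>: the sparse family \<open>SQ\<close> in \<open>Q0\<close>, the subfamily
  \<open>S'\<close> and the choice \<open>Q \<mapsto> Q\<^sup>*\<close> given by \<open>star\<close>; \<open>Sj\<close> is the \<open>j\<close>-th adjacent system.\<close>

definition sparse_operator_data ::
  "'a measure \<Rightarrow> ('a \<Rightarrow> 'a \<Rightarrow> real) \<Rightarrow> real \<Rightarrow> real \<Rightarrow> real \<Rightarrow> real \<Rightarrow> (int \<Rightarrow> 'a set set) \<Rightarrow> nat \<Rightarrow>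
   (int \<Rightarrow> 'a set set) \<Rightarrow> (int \<Rightarrow> 'a set \<Rightarrow> 'a) \<Rightarrow> ('a set \<Rightarrow> int) \<Rightarrow>
   'a set \<Rightarrow> 'a set set \<Rightarrow> 'a set set \<Rightarrow> ('a set \<Rightarrow> 'a set) \<Rightarrow> bool" where
  "sparse_operator_data M \<rho> C \<delta> \<epsilon> D Sj k S xc gen Q0 SQ S' star \<longleftrightarrow>
     dyadic_decomposition M \<rho> C \<delta> \<epsilon> S xc \<and> generation_function S gen \<and>
     Q0 \<in> (\<Union>i. S i) \<and> sparse_family_in M S Q0 SQ \<and> S' \<subseteq> SQ \<and>
     (\<forall>Q\<in>S'. star Q \<in> (\<Union>i. Sj i) \<and> dilated_cube \<rho> C \<delta> xc gen k Q \<subseteq> star Q \<and>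
             qdiam \<rho> (star Q) \<le> D * 2 ^ k * C * \<delta> powi gen Q)"

definition sparse_operator ::
  "'a measure \<Rightarrow> 'a set set \<Rightarrow> ('a set \<Rightarrow> 'a set) \<Rightarrow> ('a \<Rightarrow> real) \<Rightarrow> 'a \<Rightarrow> real" where
  "sparse_operator M S' star f x =
     (\<Sum>\<^sub>\<infinity>Q\<in>S'. (1 / measure M (star Q) * (LINT y:star Q|M. f y)) * indicator Q x)"

definition sparse_operator_adj ::
  "'a measure \<Rightarrow> 'a set set \<Rightarrow> ('a set \<Rightarrow> 'a set) \<Rightarrow> ('a \<Rightarrow> real) \<Rightarrow> 'a \<Rightarrow> real" where
  "sparse_operator_adj M S' star f x =
     (\<Sum>\<^sub>\<infinity>Q\<in>S'. (1 / measure M (star Q) * (LINT y:Q|M. f y)) * indicator (star Q) x)"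

definition median_on :: "'a measure \<Rightarrow> ('a \<Rightarrow> real) \<Rightarrow> 'a set \<Rightarrow> real" where
  "median_on M g Q = Sup {a. measure M {x \<in> Q. g x < a} \<le> 1 / 2 * measure M Q}"

end

theory Submission
  imports Defs
begin

text \<open>
  Let \<open>a\<close> be the average of \<open>\<bar>f\<bar>\<close> over \<open>Q2\<close>. It suffices to show that \<open>\<bar>B\<^sup>* f\<bar>\<close> is at most a multiple
  of \<open>k a\<close> outside a quarter of \<open>Q2\<close>: then the median is bounded by this multiple, and Cauchy-Schwarz
  with \<open>\<omega>\<close> and \<open>\<omega>\<^sup>-\<^sup>1\<close> together with \<open>[\<omega>] \<ge> 1\<close> gives the claim. Since \<open>Q2\<close> is large, every \<open>R\<^sup>*\<close>
  meeting \<open>Q2\<close> is contained in it, so only \<open>f\<close> restricted to \<open>Q2\<close> matters.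

  Call a cube of the \<open>j\<close>-th system heavy if the average of \<open>\<bar>f\<bar>\<close> over it exceeds \<open>8 a\<close>; the heavy cubes
  cover at most an eighth of \<open>Q2\<close>. Off them \<open>B\<^sup>* f\<close> only involves those \<open>R\<close> with \<open>R\<^sup>*\<close> in no heavy cube,
  and the \<open>L\<^sup>1\<close> norm of this part is at most the sum of \<open>\<integral>\<^sub>R \<bar>f\<bar>\<close>, so Chebyshev applies. Cover \<open>R\<close> by the
  cubes of the \<open>j\<close>-th system of its own generation. The cubes that are not heavy contribute at most a
  multiple of \<open>a \<bar>R\<bar>\<close>, which sums to a multiple of \<open>a \<bar>Q2\<bar>\<close> by sparseness. A point lies in a heavy cube
  of the generation of \<open>R\<close> for at most a multiple of \<open>k\<close> of the sets \<open>R\<close> containing it: a heavy cube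
  meeting \<open>R\<^sup>*\<close> is properly contained in \<open>R\<^sup>*\<close>, whose diameter is at most a multiple of \<open>2\<^sup>k\<close> times the size of \<open>R\<close>.
\<close>

subsection \<open>Measure-theoretic preliminaries\<close>

text \<open>Keep the inclusion-maximal members: in a nested family two of them are equal or
  disjoint, and by finiteness every member lies below a maximal one.\<close>

lemma pairwise_disjnt_subfamily_same_Union:
  assumes "finite \<B>"
    and "\<And>A B. A \<in> \<B> \<Longrightarrow> B \<in> \<B> \<Longrightarrow> A \<inter> B = {} \<or> A \<subseteq> B \<or> B \<subseteq> A"
  obtains \<D> where "\<D> \<subseteq> \<B>" "pairwise disjnt \<D>" "\<Union>\<D> = \<Union>\<B>"
proof -
  define \<D> where "\<D> = {A \<in> \<B>. \<forall>B\<in>\<B>. A \<subseteq> B \<longrightarrow> A = B}"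
  have "\<D> \<subseteq> \<B>" by (auto simp: \<D>_def)
  moreover have "pairwise disjnt \<D>"
  proof (rule pairwiseI)
    fix A B assume AB: "A \<in> \<D>" "B \<in> \<D>" "A \<noteq> B"
    then have "A \<inter> B = {} \<or> A \<subseteq> B \<or> B \<subseteq> A" using assms(2)[of A B] by (simp add: \<D>_def)
    then show "disjnt A B" using AB by (auto simp: \<D>_def disjnt_def)
  qed
  moreover have "\<Union>\<D> = \<Union>\<B>"
  proof
    show "\<Union>\<D> \<subseteq> \<Union>\<B>" by (auto simp: \<D>_def)
    show "\<Union>\<B> \<subseteq> \<Union>\<D>"
    proof
      fix x assume "x \<in> \<Union>\<B>"
      then obtain A where A: "A \<in> \<B>" "x \<in> A" by blast
      obtain B where B: "B \<in> \<B>" "A \<subseteq> B" "\<forall>B'\<in>\<B>. B \<subseteq> B' \<longrightarrow> B = B'"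
        using finite_has_maximal2[OF assms(1) A(1)] by auto
      then show "x \<in> \<Union>\<D>" using A by (auto simp: \<D>_def)
    qed
  qed
  ultimately show thesis by (rule that)
qed

text \<open>An infinite nested family may have no maximal members, so the family is exhausted by
  finite subfamilies. Each of these is replaced by a disjoint one with the same union, where the
  bounds add up; continuity from below gives the limit.\<close>

lemma emeasure_Union_nested_le:
  fixes c :: ennreal
  assumes sets: "sets N = sets M" "\<B> \<subseteq> sets M" and cnt: "countable \<B>"
    and nested: "\<And>A B. A \<in> \<B> \<Longrightarrow> B \<in> \<B> \<Longrightarrow> A \<inter> B = {} \<or> A \<subseteq> B \<or> B \<subseteq> A"
    and le: "\<And>A. A \<in> \<B> \<Longrightarrow> c * emeasure M A \<le> emeasure N A"
  shows "c * emeasure M (\<Union>\<B>) \<le> emeasure N (\<Union>\<B>)"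
proof (cases "\<B> = {}")
  case False
  have fin: "c * emeasure M (\<Union>\<A>) \<le> emeasure N (\<Union>\<A>)" if "finite \<A>" and AB: "\<A> \<subseteq> \<B>" for \<A>
  proof -
    obtain \<D> where D: "\<D> \<subseteq> \<A>" "pairwise disjnt \<D>" "\<Union>\<D> = \<Union>\<A>"
      by (rule pairwise_disjnt_subfamily_same_Union[OF \<open>finite \<A>\<close>]) (use AB nested in blast)
    have fD: "finite \<D>" using D(1) that(1) finite_subset by blast
    have dj: "disjoint_family_on id \<D>"
      using D(2) by (auto simp: disjoint_family_on_def pairwise_def disjnt_def)
    have "emeasure M (\<Union>\<D>) = (\<Sum>A\<in>\<D>. emeasure M A)"
      using sum_emeasure[of id \<D> M] dj fD D(1) that(2) sets by (auto simp: subset_iff)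
    moreover have "emeasure N (\<Union>\<D>) = (\<Sum>A\<in>\<D>. emeasure N A)"
      using sum_emeasure[of id \<D> N] dj fD D(1) that(2) sets by (auto simp: subset_iff)
    moreover have "c * (\<Sum>A\<in>\<D>. emeasure M A) \<le> (\<Sum>A\<in>\<D>. emeasure N A)"
      unfolding sum_distrib_left using D(1) that(2) le by (intro sum_mono) auto
    ultimately show ?thesis using D(3) by simp
  qed
  define U where "U n = \<Union>(from_nat_into \<B> ` {..n})" for n
  have inB: "from_nat_into \<B> ` {..n} \<subseteq> \<B>" for n
    using False by (auto intro: from_nat_into)
  have UB: "(\<Union>n. U n) = \<Union>\<B>"
  proof -
    have "(\<Union>n. U n) = \<Union>(range (from_nat_into \<B>))" by (auto simp: U_def)
    then show ?thesis using range_from_nat_into[OF False cnt] by simp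
  qed
  have Us: "range U \<subseteq> sets M"
    unfolding U_def using inB sets(2) by (intro image_subsetI sets.finite_Union) blast+
  have "incseq U" by (force simp: U_def incseq_def)
  then have "c * emeasure M (\<Union>\<B>) = (SUP n. c * emeasure M (U n))"
    using SUP_emeasure_incseq[OF Us] UB SUP_mult_left_ennreal[of c "\<lambda>n. emeasure M (U n)" UNIV] by simp
  also have "\<dots> \<le> emeasure N (\<Union>\<B>)"
  proof (rule SUP_least)
    fix n
    have "\<Union>\<B> \<in> sets N" unfolding sets(1) UB[symmetric] using Us by blast
    then have "emeasure N (U n) \<le> emeasure N (\<Union>\<B>)"
      using UB by (intro emeasure_mono) auto
    then show "c * emeasure M (U n) \<le> emeasure N (\<Union>\<B>)"
      using fin[OF _ inB[of n]] unfolding U_def by (meson finite_atMost finite_imageI order_trans)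
  qed
  finally show ?thesis .
qed simp

text \<open>All finite sums of the measures are at most the measure of \<open>B\<close>, so the
  measures are summable, and a summable real family has only countably many nonzero terms.\<close>

lemma countable_disjoint_positive_measure:
  assumes "\<A> \<subseteq> sets M" "B \<in> sets M" "emeasure M B < \<infinity>" "pairwise disjnt \<A>"
    and "\<And>A. A \<in> \<A> \<Longrightarrow> A \<subseteq> B \<and> 0 < emeasure M A"
  shows "countable \<A>"
proof -
  have sumle: "sum (measure M) \<F> \<le> measure M B" if "finite \<F>" "\<F> \<subseteq> \<A>" for \<F>
  proof -
    have dj: "disjoint_family_on id \<F>"
      using assms(4) that by (auto simp: disjoint_family_on_def pairwise_def disjnt_def)
    have fin: "A \<in> \<F> \<Longrightarrow> emeasure M A \<noteq> \<infinity>" for A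
      using emeasure_mono[of A B M] assms(2,3,5) that(2) by (force simp: top_unique)
    have "sum (measure M) \<F> = measure M (\<Union>\<F>)"
      using measure_finite_Union[of \<F> id M] dj that assms(1) fin by (auto simp: subset_iff)
    also have "\<dots> \<le> measure M B"
      using assms that by (intro measure_mono_fmeasurable) (auto simp: fmeasurable_def subset_iff intro!: sets.finite_Union)
    finally show ?thesis .
  qed
  have "measure M summable_on \<A>"
    using sumle by (intro nonneg_bdd_above_summable_on) (auto simp: bdd_above_def)
  then have "countable {A \<in> \<A>. measure M A \<noteq> 0}" by (rule summable_countable_real)
  moreover have "measure M A \<noteq> 0" if "A \<in> \<A>" for A
  proof -
    have "emeasure M A \<le> emeasure M B" using assms(2,5) that by (intro emeasure_mono) auto
    then show ?thesis
      using assms(3) assms(5)[OF that] by (auto simp: measure_def enn2real_eq_0_iff top_unique)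
  qed
  then have "{A \<in> \<A>. measure M A \<noteq> 0} = \<A>" by blast
  ultimately show ?thesis by simp
qed

text \<open>For \<open>a > l\<close> the sets where \<open>g < a\<close> and where
  \<open>\<bar>g\<bar> > l\<close> cover \<open>Q\<close>. If \<open>a\<close> were admissible in
  the supremum, both would have at most half the measure, the second strictly less: a contradiction.
  The value \<open>-l\<close> is itself admissible, which gives the lower bound.\<close>

lemma abs_median_on_le:
  assumes Q: "Q \<in> sets M" "emeasure M Q < \<infinity>" and g: "g \<in> borel_measurable M"
    and half: "measure M {x \<in> Q. \<bar>g x\<bar> > l} < measure M Q / 2"
  shows "\<bar>median_on M g Q\<bar> \<le> l"
proof -
  define A where "A = {a. measure M {x \<in> Q. g x < a} \<le> 1 / 2 * measure M Q}"
  have Qsp: "Q \<subseteq> space M" using Q(1) sets.sets_into_space by blast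
  have mb: "{x \<in> Q. P (g x)} \<in> fmeasurable M" if "Measurable.pred borel P" for P
  proof -
    have "{x \<in> Q. P (g x)} = Q \<inter> {x \<in> space M. P (g x)}" using Qsp by blast
    also have "\<dots> \<in> sets M"
      using Q(1) pred_def measurable_compose[OF g that] by (intro sets.Int) auto
    finally have "{x \<in> Q. P (g x)} \<in> sets M" .
    then show ?thesis by (rule fmeasurableI2[OF fmeasurableI[OF Q] Collect_subset])
  qed
  have up: "a \<le> l" if "a \<in> A" for a
  proof (rule ccontr)
    assume "\<not> a \<le> l"
    have "measure M Q \<le> measure M ({x \<in> Q. g x < a} \<union> {x \<in> Q. \<bar>g x\<bar> > l})"
      using \<open>\<not> a \<le> l\<close> Q by (intro measure_mono_fmeasurable fmeasurable.Un mb) auto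
    also have "\<dots> \<le> measure M {x \<in> Q. g x < a} + measure M {x \<in> Q. \<bar>g x\<bar> > l}"
      by (intro measure_Un_le fmeasurableD mb) auto
    finally show False using half that by (simp add: A_def)
  qed
  have "measure M {x \<in> Q. g x < -l} \<le> measure M {x \<in> Q. \<bar>g x\<bar> > l}"
    by (intro measure_mono_fmeasurable fmeasurableD mb) auto
  then have low: "-l \<in> A" using half by (simp add: A_def)
  have "Sup A \<le> l" using low up by (intro cSup_least) auto
  moreover have "-l \<le> Sup A" using low up by (intro cSup_upper) (auto simp: bdd_above_def)
  ultimately show ?thesis unfolding median_on_def A_def[symmetric] by linarith
qed

text \<open>An unconditional real sum has the default value 0 where it does not converge.
  Enumerating \<open>I\<close> turns it into a series that is summed where it converges absolutely
  and set to 0 elsewhere, and the set of absolute convergence is measurable.\<close>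

lemma borel_measurable_infsum_countable:
  fixes h :: "'b \<Rightarrow> 'a \<Rightarrow> real"
  assumes "countable I" and h: "\<And>i. i \<in> I \<Longrightarrow> h i \<in> borel_measurable M"
  shows "(\<lambda>x. \<Sum>\<^sub>\<infinity>i\<in>I. h i x) \<in> borel_measurable M"
proof -
  define e where "e = to_nat_on I"
  define H where "H n x = (if n \<in> e ` I then h (inv_into I e n) x else 0)" for n x
  have inj: "inj_on e I" unfolding e_def using assms(1) by (rule inj_on_to_nat_on)
  have Hm: "H n \<in> borel_measurable M" for n
    unfolding H_def using h inv_into_into[of n e I] by (cases "n \<in> e ` I") auto
  have eq: "(\<Sum>\<^sub>\<infinity>i\<in>I. h i x) = (if summable (\<lambda>n. \<bar>H n x\<bar>) then \<Sum>n. H n x else 0)" for x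
  proof -
    have "(\<Sum>\<^sub>\<infinity>i\<in>I. h i x) = (\<Sum>\<^sub>\<infinity>i\<in>I. H (e i) x)"
      using inj by (intro infsum_cong) (simp add: H_def)
    also have "\<dots> = infsum (\<lambda>n. H n x) (e ` I)"
      using infsum_reindex[OF inj, of "\<lambda>n. H n x"] by (simp add: o_def)
    also have "\<dots> = infsum (\<lambda>n. H n x) UNIV"
      by (intro infsum_cong_neutral) (auto simp: H_def)
    also have "\<dots> = (if summable (\<lambda>n. \<bar>H n x\<bar>) then \<Sum>n. H n x else 0)"
    proof (cases "summable (\<lambda>n. \<bar>H n x\<bar>)")
      case True
      then have "((\<lambda>n. H n x) has_sum (\<Sum>n. H n x)) UNIV"
        using norm_summable_imp_has_sum[of "\<lambda>n. H n x" "\<Sum>n. H n x"]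
        by (simp add: summable_rabs_cancel summable_sums)
      then show ?thesis using True infsumI by auto
    next
      case False
      then have "\<not> (\<lambda>n. H n x) summable_on UNIV"
        using summable_on_imp_summable[of "\<lambda>n. \<bar>H n x\<bar>"]
          summable_on_iff_abs_summable_on_real[of "\<lambda>n. H n x" UNIV] by auto
      then show ?thesis using False by (simp add: infsum_not_exists)
    qed
    finally show ?thesis .
  qed
  have "Measurable.pred M (\<lambda>x. summable (\<lambda>n. \<bar>H n x\<bar>))"
    unfolding summable_iff_convergent Cauchy_convergent_iff[symmetric] using Hm by measurable
  then show ?thesis unfolding eq using Hm by (intro measurable_If borel_measurable_suminf) auto
qed

lemma emeasure_Union_disjoint:
  assumes "countable \<A>" "\<A> \<subseteq> sets M" "pairwise disjnt \<A>"
  shows "emeasure M (\<Union>\<A>) = (\<integral>\<^sup>+A. emeasure M A \<partial>count_space \<A>)"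
proof -
  have "disjoint_family_on id \<A>"
    using assms(3) by (auto simp: disjoint_family_on_def pairwise_def disjnt_def)
  then show ?thesis using emeasure_UN_countable[of \<A> id M] assms by auto
qed

text \<open>Bounded overlap: exchanging sum and integral turns the left side into the integral of
  the number of sets containing a point.\<close>

lemma nn_integral_count_space_indicator_le:
  assumes "\<And>x. finite {i \<in> I. x \<in> A i} \<and> card {i \<in> I. x \<in> A i} \<le> n"
    and "countable I" "\<And>i. i \<in> I \<Longrightarrow> A i \<in> sets N"
  shows "(\<integral>\<^sup>+i. emeasure N (A i) \<partial>count_space I) \<le> of_nat n * emeasure N (space N)"
proof -
  have "(\<integral>\<^sup>+i. emeasure N (A i) \<partial>count_space I) = (\<integral>\<^sup>+i. \<integral>\<^sup>+x. indicator (A i) x \<partial>N \<partial>count_space I)"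
    using assms(3) by (intro nn_integral_cong) simp
  also have "\<dots> = (\<integral>\<^sup>+x. \<integral>\<^sup>+i. indicator (A i) x \<partial>count_space I \<partial>N)"
    using assms(2,3) by (intro nn_integral_count_space_nn_integral[symmetric]) auto
  also have "\<dots> \<le> (\<integral>\<^sup>+x. of_nat n \<partial>N)"
  proof (rule nn_integral_mono)
    fix x
    have "(\<integral>\<^sup>+i. indicator (A i) x \<partial>count_space I) = (\<Sum>i\<in>{i \<in> I. x \<in> A i}. indicator (A i) x :: ennreal)"
      using assms(1)[of x] by (intro nn_integral_count_space') (auto simp: indicator_def)
    also have "\<dots> = of_nat (card {i \<in> I. x \<in> A i})" by simp
    also have "\<dots> \<le> of_nat n" using assms(1)[of x] by simp
    finally show "(\<integral>\<^sup>+i. indicator (A i) x \<partial>count_space I) \<le> (of_nat n :: ennreal)" .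
  qed
  also have "\<dots> = of_nat n * emeasure N (space N)" by simp
  finally show ?thesis .
qed

text \<open>The hypothesis bounds all finite sums of absolute values, hence already yields absolute
  summability; the default value 0 of a divergent \<open>infsum\<close> cannot interfere.\<close>

lemma abs_infsum_le_nn_integral:
  fixes c :: "'b \<Rightarrow> real"
  assumes le: "(\<integral>\<^sup>+i. ennreal \<bar>c i\<bar> \<partial>count_space I) \<le> ennreal t" and t: "0 \<le> t"
  shows "\<bar>\<Sum>\<^sub>\<infinity>i\<in>I. c i\<bar> \<le> t"
proof -
  have fin: "(\<Sum>i\<in>F. \<bar>c i\<bar>) \<le> t" if "finite F" "F \<subseteq> I" for F
  proof -
    have "ennreal (\<Sum>i\<in>F. \<bar>c i\<bar>) = (\<integral>\<^sup>+i. ennreal \<bar>c i\<bar> * indicator F i \<partial>count_space I)"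
      using that by (subst nn_integral_count_space'[of F]) (auto simp: indicator_def)
    also have "\<dots> \<le> (\<integral>\<^sup>+i. ennreal \<bar>c i\<bar> \<partial>count_space I)"
      by (intro nn_integral_mono) (auto simp: indicator_def)
    finally show ?thesis using le t by (meson ennreal_le_iff order_trans)
  qed
  have "(\<lambda>i. \<bar>c i\<bar>) summable_on I"
    using fin by (intro nonneg_bdd_above_summable_on) (auto simp: bdd_above_def)
  then have "norm (\<Sum>\<^sub>\<infinity>i\<in>I. c i) \<le> (\<Sum>\<^sub>\<infinity>i\<in>I. norm (c i))"
    by (intro norm_infsum_bound) simp
  also have "\<dots> \<le> t"
    using \<open>(\<lambda>i. \<bar>c i\<bar>) summable_on I\<close> fin by (intro infsum_le_finite_sums) auto
  finally show ?thesis by simp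
qed

lemma borel_measurable_nn_integral_count_space:
  fixes f :: "'b \<Rightarrow> 'a \<Rightarrow> ennreal"
  assumes "countable I" "\<And>i. i \<in> I \<Longrightarrow> f i \<in> borel_measurable M"
  shows "(\<lambda>x. \<integral>\<^sup>+i. f i x \<partial>count_space I) \<in> borel_measurable M"
proof -
  interpret sigma_finite_measure "count_space I"
    by (rule sigma_finite_measure_count_space_countable[OF assms(1)])
  have "(\<lambda>(i, x). f i x) \<in> borel_measurable (count_space I \<Otimes>\<^sub>M M)"
    using assms by (intro measurable_pair_measure_countable1) auto
  then have "(\<lambda>(x, i). f i x) \<in> borel_measurable (M \<Otimes>\<^sub>M count_space I)"
    by (subst measurable_pair_swap_iff) (simp add: case_prod_beta')
  then show ?thesis by (rule borel_measurable_nn_integral)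
qed

lemma ennreal_abs_integral_le: "ennreal \<bar>\<integral>x. f x \<partial>M\<bar> \<le> (\<integral>\<^sup>+x. ennreal \<bar>f x\<bar> \<partial>M)"
  for f :: "'a \<Rightarrow> real"
  using integral_norm_bound_ennreal[of M f] by (cases "integrable M f") (auto simp: not_integrable_integral_eq)

lemma set_nn_integral_eq_set_integral:
  fixes g :: "'a \<Rightarrow> real"
  assumes "set_integrable M A g" "\<And>x. 0 \<le> g x"
  shows "(\<integral>\<^sup>+x\<in>A. ennreal (g x) \<partial>M) = ennreal (LINT x:A|M. g x)"
proof -
  have "(\<integral>\<^sup>+x\<in>A. ennreal (g x) \<partial>M) = (\<integral>\<^sup>+x. ennreal (indicator A x *\<^sub>R g x) \<partial>M)"
    by (intro nn_integral_cong) (auto simp: indicator_def)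
  then show ?thesis
    using assms nn_integral_eq_integral[of M "\<lambda>x. indicator A x *\<^sub>R g x"]
    by (simp add: set_integrable_def set_lebesgue_integral_def)
qed

text \<open>Factor \<open>\<bar>f x\<bar>\<close> as \<open>\<bar>f x\<bar> * sqrt (w x)\<close>
  times \<open>1 / sqrt (w x)\<close> and apply the unweighted inequality.\<close>

lemma Cauchy_Schwarz_weight:
  fixes f w :: "'a \<Rightarrow> real"
  assumes [measurable]: "f \<in> borel_measurable M" "w \<in> borel_measurable M" "E \<in> sets M"
    and w: "\<And>x. 0 \<le> w x" and fin: "(\<integral>\<^sup>+x\<in>E. inverse (ennreal (w x)) \<partial>M) < \<infinity>"
  shows "(\<integral>\<^sup>+x\<in>E. ennreal \<bar>f x\<bar> \<partial>M)\<^sup>2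
    \<le> (\<integral>\<^sup>+x\<in>E. ennreal (\<bar>f x\<bar>\<^sup>2 * w x) \<partial>M) * (\<integral>\<^sup>+x\<in>E. inverse (ennreal (w x)) \<partial>M)"
proof -
  let ?F = "\<lambda>x. ennreal (\<bar>f x\<bar> * sqrt (w x)) * indicator E x"
  let ?G = "\<lambda>x. ennreal (1 / sqrt (w x)) * indicator E x"
  \<comment> \<open>The factorisation fails where \<open>w\<close> vanishes. There the reciprocal in
    \<open>ennreal\<close> is infinite, so finiteness of its integral confines this to a null subset
    of \<open>E\<close>.\<close>
  have "AE x in M. inverse (ennreal (w x)) * indicator E x \<noteq> \<infinity>"
    using fin by (intro nn_integral_PInf_AE) auto
  then have pos: "AE x in M. x \<in> E \<longrightarrow> 0 < w x"
  proof eventually_elim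
    case (elim x)
    then show ?case using w[of x] by (cases "w x = 0") (auto simp: less_le)
  qed
  have "(\<integral>\<^sup>+x\<in>E. ennreal \<bar>f x\<bar> \<partial>M) = (\<integral>\<^sup>+x. ?F x * ?G x \<partial>M)"
  proof (rule nn_integral_cong_AE, use pos in eventually_elim)
    case (elim x)
    then show ?case by (cases "x \<in> E") (auto simp: ennreal_mult[symmetric])
  qed
  also have "\<dots>\<^sup>2 \<le> (\<integral>\<^sup>+x. (?F x)\<^sup>2 \<partial>M) * (\<integral>\<^sup>+x. (?G x)\<^sup>2 \<partial>M)"
    by (rule Cauchy_Schwarz_nn_integral) measurable
  also have "(\<integral>\<^sup>+x. (?F x)\<^sup>2 \<partial>M) = (\<integral>\<^sup>+x\<in>E. ennreal (\<bar>f x\<bar>\<^sup>2 * w x) \<partial>M)"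
    using w by (intro nn_integral_cong) (auto simp: indicator_def ennreal_power power_mult_distrib)
  also have "(\<integral>\<^sup>+x. (?G x)\<^sup>2 \<partial>M) = (\<integral>\<^sup>+x\<in>E. inverse (ennreal (w x)) \<partial>M)"
  proof (rule nn_integral_cong_AE, use pos in eventually_elim)
    case (elim x)
    then show ?case
      by (cases "x \<in> E") (auto simp: ennreal_power power_divide inverse_ennreal inverse_eq_divide)
  qed
  finally show ?thesis .
qed

subsection \<open>Doubling spaces and dyadic systems\<close>

locale doubling_space =
  fixes M :: "'a measure" and \<rho> :: "'a \<Rightarrow> 'a \<Rightarrow> real" and C0 Cd :: real
  assumes rho_nonneg: "0 \<le> \<rho> x y"
    and rho_self: "\<rho> x x = 0"
    and rho_sym: "\<rho> x y = \<rho> y x"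
    and rho_triangle: "\<rho> x z \<le> C0 * (\<rho> x y + \<rho> y z)"
    and C0_ge1: "1 \<le> C0"
    and Cd_ge1: "1 \<le> Cd"
    and space_M: "space M = UNIV"
    and qball_sets: "0 < r \<Longrightarrow> qball \<rho> x r \<in> sets M"
    and qball_pos: "0 < r \<Longrightarrow> 0 < emeasure M (qball \<rho> x r)"
    and qball_finite: "0 < r \<Longrightarrow> emeasure M (qball \<rho> x r) < \<infinity>"
    and qball_doubling: "0 < r \<Longrightarrow> emeasure M (qball \<rho> x (2 * r)) \<le> ennreal Cd * emeasure M (qball \<rho> x r)"

text \<open>Both constants are enlarged to at least 1, which preserves the inequalities. The
  definition states positivity for the ball of radius \<open>2 * r\<close>, so a ball of radius
  \<open>r\<close> is reached from \<open>r / 2\<close>.\<close>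

lemma homogeneous_space_imp_doubling_space:
  assumes "homogeneous_space M \<rho>"
  obtains C0 Cd where "doubling_space M \<rho> C0 Cd"
proof -
  have quasi: "\<And>x y. 0 \<le> \<rho> x y" "\<And>x. \<rho> x x = 0" "\<And>x y. \<rho> x y = \<rho> y x"
    using assms by (auto simp: homogeneous_space_def quasimetric_def)
  obtain c0 where c0: "\<And>x y z. \<rho> x z \<le> c0 * (\<rho> x y + \<rho> y z)"
    using assms by (auto simp: homogeneous_space_def quasimetric_def)
  obtain cd where cd: "\<And>x r. 0 < r \<Longrightarrow> 0 < emeasure M (qball \<rho> x (2 * r)) \<and>
        emeasure M (qball \<rho> x (2 * r)) \<le> ennreal cd * emeasure M (qball \<rho> x r) \<and>
        emeasure M (qball \<rho> x r) < \<infinity>"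
    using assms unfolding homogeneous_space_def by blast
  have "\<rho> x z \<le> max c0 1 * (\<rho> x y + \<rho> y z)" for x y z
    using c0[of x z y] mult_right_mono[of c0 "max c0 1" "\<rho> x y + \<rho> y z"] quasi(1)[of x y] quasi(1)[of y z]
    by linarith
  moreover have "emeasure M (qball \<rho> x (2 * r)) \<le> ennreal (max cd 1) * emeasure M (qball \<rho> x r)"
    if "0 < r" for x r
    using cd[OF that, of x] mult_right_mono[of "ennreal cd" "ennreal (max cd 1)" "emeasure M (qball \<rho> x r)"]
    by (meson dual_order.trans ennreal_leI max.cobounded1 zero_le)
  moreover have "0 < emeasure M (qball \<rho> x r)" if "0 < r" for x r
    using cd[of "r / 2" x] that by simp
  moreover have "space M = UNIV" "\<And>x r. 0 < r \<Longrightarrow> qball \<rho> x r \<in> sets M"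
    using assms by (auto simp: homogeneous_space_def)
  ultimately have "doubling_space M \<rho> (max c0 1) (max cd 1)"
    using quasi cd by unfold_locales auto
  then show thesis by (rule that)
qed

context doubling_space
begin

lemma qball_mono: "r \<le> s \<Longrightarrow> qball \<rho> x r \<subseteq> qball \<rho> x s"
  by (auto simp: qball_def)

lemma emeasure_qball_power2_le:
  assumes "0 < r"
  shows "emeasure M (qball \<rho> x (2 ^ m * r)) \<le> ennreal (Cd ^ m) * emeasure M (qball \<rho> x r)"
proof (induction m)
  case (Suc m)
  have "emeasure M (qball \<rho> x (2 ^ Suc m * r)) \<le> ennreal Cd * emeasure M (qball \<rho> x (2 ^ m * r))"
    using qball_doubling[of "2 ^ m * r" x] assms by (simp add: mult.assoc)
  also have "\<dots> \<le> ennreal Cd * (ennreal (Cd ^ m) * emeasure M (qball \<rho> x r))"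
    using Suc by (intro mult_left_mono) auto
  also have "\<dots> = ennreal (Cd ^ Suc m) * emeasure M (qball \<rho> x r)"
    using Cd_ge1 by (simp add: ennreal_mult mult.assoc)
  finally show ?case .
qed simp

end

locale dyadic_system = doubling_space +
  fixes C \<delta> \<epsilon> :: real and S :: "int \<Rightarrow> 'a set set" and xc :: "int \<Rightarrow> 'a set \<Rightarrow> 'a"
  assumes C_pos: "0 < C" and \<delta>_pos: "0 < \<delta>" and \<delta>_less1: "\<delta> < 1"
    and dyadic: "dyadic_decomposition M \<rho> C \<delta> \<epsilon> S xc"
begin

lemma \<delta>_powi_pos [simp]: "0 < \<delta> powi i"
  using \<delta>_pos by simp

lemma cube_sets: "Q \<in> S i \<Longrightarrow> Q \<in> sets M"
  using dyadic by (auto simp: dyadic_decomposition_def)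

lemma null_compl: "UNIV - \<Union>(S i) \<in> null_sets M"
  using dyadic by (simp add: dyadic_decomposition_def space_M)

lemma cubes_nested: "P \<in> S i \<Longrightarrow> Q \<in> S j \<Longrightarrow> P \<inter> Q = {} \<or> P \<subseteq> Q \<or> Q \<subseteq> P"
  using dyadic unfolding dyadic_decomposition_def by simp

lemma ex_child: "Q \<in> S i \<Longrightarrow> \<exists>R\<in>S (i + 1). R \<subseteq> Q"
  using dyadic unfolding dyadic_decomposition_def by simp

lemma ex1_parent: "Q \<in> S i \<Longrightarrow> \<exists>!R. R \<in> S (i - 1) \<and> Q \<subseteq> R"
  using dyadic unfolding dyadic_decomposition_def by simp

lemma qball_subset_cube: "Q \<in> S i \<Longrightarrow> qball \<rho> (xc i Q) (\<delta> powi i) \<subseteq> Q"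
  using dyadic unfolding dyadic_decomposition_def by simp

lemma cube_subset_qball: "Q \<in> S i \<Longrightarrow> Q \<subseteq> qball \<rho> (xc i Q) (C * \<delta> powi i)"
  using dyadic unfolding dyadic_decomposition_def by simp

lemma xc_in_cube: "Q \<in> S i \<Longrightarrow> xc i Q \<in> Q"
  using qball_subset_cube[of Q i] by (auto simp: qball_def rho_self)

lemma emeasure_cube_pos: "Q \<in> S i \<Longrightarrow> 0 < emeasure M Q"
  using emeasure_mono[OF qball_subset_cube cube_sets] qball_pos[of "\<delta> powi i" "xc i Q"]
  by (meson \<delta>_powi_pos less_le_trans)

lemma emeasure_cube_finite: "Q \<in> S i \<Longrightarrow> emeasure M Q < \<infinity>"
  using emeasure_mono[OF cube_subset_qball qball_sets, of Q i] qball_finite[of "C * \<delta> powi i" "xc i Q"]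
    C_pos by (metis \<delta>_powi_pos le_less_trans mult_pos_pos)

lemma emeasure_cube_eq_measure: "Q \<in> S i \<Longrightarrow> emeasure M Q = ennreal (measure M Q)"
  using emeasure_cube_finite by (metis emeasure_eq_ennreal_measure infinity_ennreal_def less_irrefl)

lemma measure_cube_pos: "Q \<in> S i \<Longrightarrow> 0 < measure M Q"
  using emeasure_cube_pos emeasure_cube_eq_measure by fastforce

text \<open>Doubling is iterated \<open>m\<close> times starting from the inner ball of radius
  \<open>\<delta> powi i\<close>, which lies in \<open>Q\<close>.\<close>

lemma emeasure_dilated_le:
  assumes "Q \<in> S i" "c \<le> 2 ^ m" "0 < c"
  shows "emeasure M (qball \<rho> (xc i Q) (c * \<delta> powi i)) \<le> ennreal (Cd ^ m) * emeasure M Q"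
proof -
  have "emeasure M (qball \<rho> (xc i Q) (c * \<delta> powi i)) \<le> emeasure M (qball \<rho> (xc i Q) (2 ^ m * \<delta> powi i))"
    using assms by (intro emeasure_mono qball_mono qball_sets mult_right_mono) (auto intro: less_imp_le)
  also have "\<dots> \<le> ennreal (Cd ^ m) * emeasure M (qball \<rho> (xc i Q) (\<delta> powi i))"
    by (rule emeasure_qball_power2_le) simp
  also have "\<dots> \<le> ennreal (Cd ^ m) * emeasure M Q"
    using assms by (intro mult_left_mono emeasure_mono qball_subset_cube cube_sets) auto
  finally show ?thesis .
qed

text \<open>Nested cubes of one generation share a child, whose parent is unique.\<close>

lemma cubes_same_generation_eq:
  assumes "P \<in> S i" "Q \<in> S i" "P \<inter> Q \<noteq> {}"
  shows "P = Q"
proof -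
  have *: "A = B" if A: "A \<in> S i" and "B \<in> S i" "A \<subseteq> B" for A B
  proof -
    obtain R where R: "R \<in> S (i + 1)" "R \<subseteq> A" using ex_child[OF A] by blast
    have "\<exists>!P. P \<in> S i \<and> R \<subseteq> P" using ex1_parent[OF R(1)] by simp
    then show ?thesis using R(2) that by (metis subset_trans)
  qed
  show ?thesis using cubes_nested[OF assms(1,2)] assms *[of P Q] *[of Q P] by blast
qed

lemma pairwise_disjnt_generation: "pairwise disjnt (S i)"
  using cubes_same_generation_eq unfolding pairwise_def disjnt_def by blast

lemma ex_ancestor:
  assumes "j \<le> i" "Q \<in> S i"
  shows "\<exists>P\<in>S j. Q \<subseteq> P"
  using assms(1)
proof (induction j rule: int_le_induct)
  case base
  then show ?case using assms(2) by blast
next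
  case (step l)
  then obtain P where "P \<in> S l" "Q \<subseteq> P" by blast
  then show ?case using ex1_parent[of P l] by (meson subset_trans)
qed

text \<open>Otherwise \<open>P\<close> has an ancestor in the generation of \<open>Q\<close>; it
  meets \<open>Q\<close>, hence equals \<open>Q\<close>, and \<open>P\<close> would lie in
  \<open>Q\<close>. Strict inclusion matters because one set can be a cube of several
  generations.\<close>

lemma generation_le_if_psubset:
  assumes "Q \<in> S i" "P \<in> S j" "Q \<subset> P"
  shows "j \<le> i"
proof (rule ccontr)
  assume "\<not> j \<le> i"
  then obtain R where R: "R \<in> S i" "P \<subseteq> R" using ex_ancestor[OF _ assms(2)] by (meson linorder_linear)
  then have "Q = R" using cubes_same_generation_eq[OF assms(1) R(1)] assms xc_in_cube[OF assms(1)] by blast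
  then show False using R assms by blast
qed

lemma rho_less_in_cube:
  assumes "Q \<in> S i" "x \<in> Q" "y \<in> Q"
  shows "\<rho> x y < C0 * (2 * C * \<delta> powi i)"
proof -
  have "\<rho> (xc i Q) x < C * \<delta> powi i" "\<rho> (xc i Q) y < C * \<delta> powi i"
    using cube_subset_qball[OF assms(1)] assms by (auto simp: qball_def)
  then have "\<rho> x (xc i Q) + \<rho> (xc i Q) y < 2 * C * \<delta> powi i" by (simp add: rho_sym)
  then show ?thesis
    using rho_triangle[of x y "xc i Q"] C0_ge1 by (smt (verit) mult_strict_left_mono)
qed

text \<open>\<open>qdiam\<close> is a supremum of reals, so its order properties are available only
  once the set of distances is known to be bounded.\<close>

lemma bdd_above_rho_cube:
  assumes "Q \<in> S i"
  shows "bdd_above {\<rho> x y |x y. x \<in> Q \<and> y \<in> Q}"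
  using rho_less_in_cube[OF assms] by (auto simp: bdd_above_def intro!: exI[of _ "C0 * (2 * C * \<delta> powi i)"] less_imp_le)

lemma rho_le_qdiam:
  assumes "Q \<in> S i" "x \<in> Q" "y \<in> Q"
  shows "\<rho> x y \<le> qdiam \<rho> Q"
  unfolding qdiam_def using assms by (intro cSup_upper bdd_above_rho_cube[OF assms(1)]) auto

lemma qdiam_mono:
  assumes "P \<in> S j" "Q \<in> S i" "Q \<subseteq> P"
  shows "qdiam \<rho> Q \<le> qdiam \<rho> P"
  unfolding qdiam_def
  using assms xc_in_cube[OF assms(2)] by (intro cSup_subset_mono bdd_above_rho_cube[OF assms(1)]) auto

text \<open>Every cube is bounded, hence lies in one of countably many balls about a fixed point,
  and a ball of finite measure holds only countably many disjoint sets of positive measure.\<close>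

lemma countable_generation: "countable (S i)"
proof -
  fix x0 :: 'a
  let ?A = "\<lambda>n. {Q \<in> S i. Q \<subseteq> qball \<rho> x0 (real (Suc n))}"
  have "countable (?A n)" for n
  proof (rule countable_disjoint_positive_measure[of _ M "qball \<rho> x0 (real (Suc n))"])
    show "pairwise disjnt (?A n)"
      using pairwise_disjnt_generation by (rule pairwise_subset) auto
  qed (auto simp: cube_sets emeasure_cube_pos qball_sets qball_finite[unfolded infinity_ennreal_def] simp del: of_nat_Suc)
  moreover have "S i \<subseteq> (\<Union>n. ?A n)"
  proof
    fix Q assume Q: "Q \<in> S i"
    let ?b = "C0 * (\<rho> x0 (xc i Q) + C0 * (2 * C * \<delta> powi i))"
    obtain n where n: "?b < real n" using reals_Archimedean2 by blast
    have "\<rho> x0 y < real (Suc n)" if "y \<in> Q" for y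
    proof -
      have "\<rho> x0 y \<le> C0 * (\<rho> x0 (xc i Q) + \<rho> (xc i Q) y)" by (rule rho_triangle)
      also have "\<dots> \<le> ?b"
        using rho_less_in_cube[OF Q xc_in_cube[OF Q] that] C0_ge1 by (intro mult_left_mono) auto
      finally show ?thesis using n by simp
    qed
    then show "Q \<in> (\<Union>n. ?A n)" using Q by (auto simp: qball_def)
  qed
  ultimately show ?thesis by (meson countable_UN countable_subset countableI_type)
qed

lemma countable_cubes: "countable (\<Union>i. S i)"
  using countable_generation by (intro countable_UN) auto

end

subsection \<open>Sparse families\<close>

text \<open>\<open>T\<close> is the adjacent system that contains the cubes \<open>star R\<close>
  and \<open>Q2\<close>; \<open>S\<close> is the system of \<open>Q0\<close> and the sparse family.
  The two share all constants, so generations can be compared across them.\<close>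

locale sparse_operator_setting =
  T: dyadic_system M \<rho> C0 Cd C \<delta> \<epsilon> T xt + S: dyadic_system M \<rho> C0 Cd C \<delta> \<epsilon> S xc
  for M :: "'a measure" and \<rho> C0 Cd C \<delta> \<epsilon> T xt S xc +
  fixes D :: real and k :: nat and gen :: "'a set \<Rightarrow> int" and Q0 :: "'a set" and SQ S' :: "'a set set"
    and star :: "'a set \<Rightarrow> 'a set"
  assumes D_pos: "0 < D" and k_ge1: "1 \<le> k"
    and data: "sparse_operator_data M \<rho> C \<delta> \<epsilon> D T k S xc gen Q0 SQ S' star"
begin

lemma sparse: "sparse_family_in M S Q0 SQ" and S'_subset: "S' \<subseteq> SQ"
  using data by (auto simp: sparse_operator_data_def)

lemma in_S_gen: "R \<in> (\<Union>i. S i) \<Longrightarrow> R \<in> S (gen R)"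
  using data by (auto simp: sparse_operator_data_def generation_function_def)

lemma SQ_cubes: "R \<in> SQ \<Longrightarrow> R \<in> (\<Union>i. S i)" and SQ_subset_Q0: "R \<in> SQ \<Longrightarrow> R \<subseteq> Q0"
  using sparse unfolding sparse_family_in_def by auto

lemma S'_gen: "R \<in> S' \<Longrightarrow> R \<in> S (gen R)"
  using in_S_gen SQ_cubes S'_subset by blast

lemma Q0_gen: "Q0 \<in> S (gen Q0)"
  using data in_S_gen unfolding sparse_operator_data_def by simp

lemma star_cube: "R \<in> S' \<Longrightarrow> \<exists>i. star R \<in> T i"
  and dilated_subset_star: "R \<in> S' \<Longrightarrow> dilated_cube \<rho> C \<delta> xc gen k R \<subseteq> star R"
  and qdiam_star: "R \<in> S' \<Longrightarrow> qdiam \<rho> (star R) \<le> D * 2 ^ k * C * \<delta> powi gen R"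
  using data by (auto simp: sparse_operator_data_def)

lemma countable_S': "countable S'"
  using S.countable_cubes by (rule countable_subset[rotated]) (use S'_subset SQ_cubes in blast)

lemma subset_star:
  assumes "R \<in> S'" shows "R \<subseteq> star R"
proof -
  have "C * \<delta> powi gen R \<le> 2 ^ k * C * \<delta> powi gen R"
    using S.C_pos one_le_power[of "2::real" k] by simp
  then have "qball \<rho> (xc (gen R) R) (C * \<delta> powi gen R) \<subseteq> dilated_cube \<rho> C \<delta> xc gen k R"
    unfolding dilated_cube_def by (rule T.qball_mono)
  then show ?thesis
    using S.cube_subset_qball[OF S'_gen[OF assms]] dilated_subset_star[OF assms] by blast
qed

lemma gen_Q0_le:
  assumes "R \<in> S'" shows "gen Q0 \<le> gen R"
proof (cases "R = Q0")
  case False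
  then show ?thesis
    using S.generation_le_if_psubset[OF S'_gen[OF assms] Q0_gen] SQ_subset_Q0 S'_subset assms by blast
qed simp

text \<open>This is where the size of \<open>Q2\<close> enters. If \<open>Q2\<close> were inside
  \<open>star R\<close>, its diameter would be at most that of \<open>star R\<close>, which is
  controlled by the generation of \<open>R\<close> and hence by the earlier generation of
  \<open>Q0\<close>.\<close>

lemma star_subset:
  assumes "R \<in> S'" "Q2 \<in> T i" "qdiam \<rho> Q2 > D * 2 ^ k * C * \<delta> powi gen Q0" "star R \<inter> Q2 \<noteq> {}"
  shows "star R \<subseteq> Q2"
proof (rule ccontr)
  assume "\<not> star R \<subseteq> Q2"
  obtain j where j: "star R \<in> T j" using star_cube[OF assms(1)] by blast
  have "Q2 \<subseteq> star R" using T.cubes_nested[OF j assms(2)] assms(4) \<open>\<not> star R \<subseteq> Q2\<close> by blast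
  then have "qdiam \<rho> Q2 \<le> qdiam \<rho> (star R)" by (rule T.qdiam_mono[OF j assms(2)])
  also have "\<dots> \<le> D * 2 ^ k * C * \<delta> powi gen R" by (rule qdiam_star[OF assms(1)])
  also have "\<dots> \<le> D * 2 ^ k * C * \<delta> powi gen Q0"
    using D_pos S.C_pos S.\<delta>_pos S.\<delta>_less1 gen_Q0_le[OF assms(1)]
    by (intro mult_left_mono power_int_decreasing) auto
  finally show False using assms(3) by simp
qed

text \<open>Here \<open>P\<close> lies properly inside \<open>star R\<close>. A point of
  \<open>star R\<close> outside \<open>P\<close> has distance at least
  \<open>\<delta> powi i\<close> from the centre of \<open>P\<close>, so the diameter bound for
  \<open>star R\<close> limits how late the generation of \<open>R\<close> can be.\<close>

lemma generation_gap:
  assumes p: "2 * max (D * C) 1 < (1 / \<delta>) ^ p"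
    and R: "R \<in> S'" and P: "P \<in> T i" and meet: "star R \<inter> P \<noteq> {}" and not: "\<not> star R \<subseteq> P"
  shows "gen R < i + int (p * k)"
proof (rule ccontr)
  assume neg: "\<not> gen R < i + int (p * k)"
  obtain j where j: "star R \<in> T j" using star_cube[OF R] by blast
  have sub: "P \<subseteq> star R" using T.cubes_nested[OF j P] meet not by blast
  obtain y where y: "y \<in> star R" "y \<notin> P" using not by blast
  have "\<delta> powi i \<le> \<rho> (xt i P) y" using T.qball_subset_cube[OF P] y by (force simp: qball_def)
  also have "\<dots> \<le> qdiam \<rho> (star R)"
    using T.rho_le_qdiam[OF j _ y(1)] T.xc_in_cube[OF P] sub by blast
  also have "\<dots> \<le> D * 2 ^ k * C * \<delta> powi gen R" by (rule qdiam_star[OF R])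
  finally have le: "\<delta> powi i \<le> D * 2 ^ k * C * \<delta> powi gen R" .
  have k0: "k \<noteq> 0" using k_ge1 by simp
  \<comment> \<open>Replacing \<open>D * C\<close> by the maximum with 1 lets it be absorbed into a
    \<open>k\<close>-th power, so that the gap is linear in \<open>k\<close> with a factor
    \<open>p\<close> independent of \<open>k\<close>.\<close>
  have "D * C * 2 ^ k \<le> max (D * C) 1 ^ k * 2 ^ k"
    using self_le_power[of "max (D * C) 1" k] k_ge1 by (intro mult_right_mono) auto
  also have "\<dots> = (2 * max (D * C) 1) ^ k" by (simp add: power_mult_distrib)
  also have "\<dots> < ((1 / \<delta>) ^ p) ^ k"
    using p k0 by (intro power_strict_mono) auto
  also have "\<dots> = (1 / \<delta>) ^ (p * k)" by (simp add: power_mult)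
  finally have "D * C * 2 ^ k * \<delta> powi gen R < (1 / \<delta>) ^ (p * k) * \<delta> powi gen R" by simp
  also have "\<dots> = \<delta> powi (gen R - int (p * k))"
    using S.\<delta>_pos power_int_of_nat[of \<delta> "p * k"] by (simp add: power_int_diff power_divide del: of_nat_mult)
  also have "\<dots> \<le> \<delta> powi i"
    using neg S.\<delta>_pos S.\<delta>_less1 by (intro power_int_decreasing) auto
  finally show False using le by (simp add: mult_ac)
qed

text \<open>The sets \<open>R - \<Union>(\<C> (n + 1))\<close> with \<open>R \<in> \<C> n\<close> are disjoint and fill at least half of \<open>R\<close>.\<close>

lemma sparse_packing:
  assumes "F \<subseteq> SQ" "\<And>R. R \<in> F \<Longrightarrow> R \<subseteq> B" "B \<in> sets M"
  shows "(\<integral>\<^sup>+R. emeasure M R \<partial>count_space F) \<le> 2 * emeasure M B"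
proof -
  obtain \<C> :: "nat \<Rightarrow> 'a set set" where SQ: "SQ = (\<Union>n. \<C> n)"
    and dj: "\<And>n. pairwise disjnt (\<C> n)"
    and par: "\<And>n Q. n > 0 \<Longrightarrow> Q \<in> \<C> n \<Longrightarrow> \<exists>Q'\<in>\<C> (n - 1). Q \<subseteq> Q'"
    and half: "\<And>n Q. Q \<in> \<C> n \<Longrightarrow> measure M (\<Union>(\<C> (n + 1)) \<inter> Q) \<le> measure M Q / 2"
    using sparse unfolding sparse_family_in_def
    by (elim exE conjE) (rule that, assumption, simp_all)
  have cube: "R \<in> S (gen R)" if "R \<in> \<C> n" for R n
    using that SQ SQ_cubes in_S_gen by blast
  have Cn_sets: "\<Union>(\<C> n) \<in> sets M" for n
    using cube S.cube_sets by (intro sets.countable_Union countable_subset[OF _ S.countable_cubes]) blast+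
  have desc: "\<exists>Q'\<in>\<C> m. Q \<subseteq> Q'" if "m \<le> n" "Q \<in> \<C> n" for m n Q
    using that
  proof (induction n arbitrary: Q rule: dec_induct)
    case base
    then show ?case by blast
  next
    case (step n)
    then obtain Q' where "Q' \<in> \<C> n" "Q \<subseteq> Q'" using par[of "Suc n" Q] by auto
    then show ?case using step.IH[of Q'] by blast
  qed
  \<comment> \<open>A set may occur in several layers; \<open>lev\<close> fixes one of them.\<close>
  define lev where "lev R = (SOME n. R \<in> \<C> n)" for R
  have lev: "R \<in> \<C> (lev R)" if "R \<in> F" for R
  proof -
    have "R \<in> (\<Union>n. \<C> n)" using that assms(1) SQ by (simp add: subset_iff)
    then show ?thesis unfolding lev_def by (auto intro: someI)
  qed
  define E where "E R = R - \<Union>(\<C> (lev R + 1))" for R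
  have E_sets: "E R \<in> sets M" if "R \<in> F" for R
    unfolding E_def using Cn_sets S.cube_sets[OF cube[OF lev[OF that]]] by blast
  have E_disj: "E R \<inter> E R' = {}" if "R \<in> F" "R' \<in> F" "R \<noteq> R'" for R R'
  proof -
    have *: "E P \<inter> E P' = {}" if "P \<in> F" and P': "P' \<in> F" and "P \<noteq> P'" and le: "lev P \<le> lev P'" for P P'
    proof (cases "lev P = lev P'")
      case True
      then show ?thesis
        using dj[of "lev P"] lev[OF that(1)] lev[OF that(2)] that(3) by (auto simp: pairwise_def disjnt_def E_def)
    next
      \<comment> \<open>The set \<open>P'\<close> of the later layer lies in a member of the layer
        right after that of \<open>P\<close>, and this member was removed from
        \<open>E P\<close>.\<close>
      case False
      then obtain P'' where "P'' \<in> \<C> (lev P + 1)" "P' \<subseteq> P''"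
        using desc[OF _ lev[OF P'], of "lev P + 1"] le by auto
      then show ?thesis by (auto simp: E_def)
    qed
    show ?thesis using *[OF that] *[of R' R] that by (metis inf_commute linear)
  qed
  have E_half: "emeasure M R \<le> 2 * emeasure M (E R)" if "R \<in> F" for R
  proof -
    note R = cube[OF lev[OF that]]
    have fin: "R \<in> fmeasurable M" using S.cube_sets[OF R] S.emeasure_cube_finite[OF R] by (rule fmeasurableI)
    have "measure M (E R) = measure M R - measure M (\<Union>(\<C> (lev R + 1)) \<inter> R)"
      using measure_Diff[of M R "\<Union>(\<C> (lev R + 1)) \<inter> R"] Cn_sets[of "lev R + 1"] S.cube_sets[OF R]
        S.emeasure_cube_finite[OF R] by (auto simp: E_def Diff_Int2 Diff_Int)
    then have "measure M R \<le> 2 * measure M (E R)" using half[OF lev[OF that]] by linarith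
    moreover have "E R \<in> fmeasurable M"
      by (rule fmeasurableI2[OF fin _ E_sets[OF that]]) (auto simp: E_def)
    ultimately show ?thesis
      using S.emeasure_cube_eq_measure[OF R] emeasure_eq_measure2[of "E R" M]
      by (simp add: ennreal_leI flip: ennreal_numeral ennreal_mult)
  qed
  have cF: "countable F"
    using S.countable_cubes by (rule countable_subset[rotated]) (use assms(1) SQ_cubes in blast)
  have "(\<integral>\<^sup>+R. emeasure M R \<partial>count_space F) \<le> (\<integral>\<^sup>+R. 2 * emeasure M (E R) \<partial>count_space F)"
    using E_half by (intro nn_integral_mono) simp
  also have "\<dots> = 2 * (\<integral>\<^sup>+R. emeasure M (E R) \<partial>count_space F)"
    by (rule nn_integral_cmult) simp
  also have "(\<integral>\<^sup>+R. emeasure M (E R) \<partial>count_space F) = emeasure M (\<Union>(E ` F))"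
    using E_sets E_disj cF by (intro emeasure_UN_countable[symmetric]) (auto simp: disjoint_family_on_def)
  also have "2 * \<dots> \<le> 2 * emeasure M B"
    using assms(2,3) by (intro mult_left_mono emeasure_mono) (auto simp: E_def)
  finally show ?thesis .
qed

end

subsection \<open>Heavy cubes\<close>

context sparse_operator_setting
begin

text \<open>The union of this family is the set where the dyadic maximal function of
  \<open>N\<close> relative to \<open>M\<close> exceeds \<open>b\<close>.\<close>

definition heavy :: "'a measure \<Rightarrow> ennreal \<Rightarrow> 'a set set" where
  "heavy N b = {P \<in> (\<Union>i. T i). b * emeasure M P < emeasure N P}"

text \<open>At a point of \<open>Q2\<close> outside all heavy cubes, these are the only
  \<open>R\<close> that can contribute to the adjoint operator.\<close>

definition light_family :: "'a measure \<Rightarrow> ennreal \<Rightarrow> 'a set \<Rightarrow> 'a set set" where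
  "light_family N b Q2 = {R \<in> S'. star R \<subseteq> Q2 \<and> (\<forall>P\<in>heavy N b. \<not> star R \<subseteq> P)}"

lemma countable_heavy: "countable (heavy N b)"
  using T.countable_cubes by (rule countable_subset[rotated]) (auto simp: heavy_def)

lemma heavy_sets: "heavy N b \<subseteq> sets M"
  using T.cube_sets by (auto simp: heavy_def)

text \<open>The weak-type bound for the dyadic maximal function; nestedness of the cubes replaces a
  covering argument.\<close>

lemma emeasure_heavy_Union_le:
  assumes "sets N = sets M"
  shows "b * emeasure M (\<Union>(heavy N b)) \<le> emeasure N (\<Union>(heavy N b))"
  using assms heavy_sets countable_heavy
proof (rule emeasure_Union_nested_le)
  fix A B assume "A \<in> heavy N b" "B \<in> heavy N b"
  then obtain i j where "A \<in> T i" "B \<in> T j" by (auto simp: heavy_def)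
  then show "A \<inter> B = {} \<or> A \<subseteq> B \<or> B \<subseteq> A" by (rule T.cubes_nested)
qed (auto simp: heavy_def intro: less_imp_le)

text \<open>The non-heavy cubes of generation \<open>i\<close> that meet \<open>R\<close> are
  disjoint and each satisfies the average bound \<open>b\<close>. Since they have the scale of
  \<open>R\<close>, they lie in a fixed dilate of its ball, comparable to \<open>R\<close> by
  doubling.\<close>

lemma emeasure_light_part_le:
  assumes N: "sets N = sets M" and R: "R \<in> S i" and m: "C0 * (C + C0 * (2 * C)) \<le> 2 ^ m"
  shows "emeasure N (R \<inter> \<Union>(T i - heavy N b)) \<le> b * (ennreal (Cd ^ m) * emeasure M R)"
proof -
  let ?c = "C0 * (C + C0 * (2 * C))"
  define G where "G = {P \<in> T i - heavy N b. P \<inter> R \<noteq> {}}"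
  have c_pos: "0 < ?c" using S.C_pos T.C0_ge1 by (simp add: add_pos_pos)
  have G: "countable G" "G \<subseteq> sets M" "pairwise disjnt G"
    using T.countable_generation[of i] T.cube_sets pairwise_subset[OF T.pairwise_disjnt_generation[of i], of G]
    by (auto simp: G_def intro: countable_subset)
  have GU: "\<Union>G \<in> sets M" using G by (intro sets.countable_Union) auto
  have "emeasure N (R \<inter> \<Union>(T i - heavy N b)) \<le> emeasure N (\<Union>G)"
    using GU N by (intro emeasure_mono) (auto simp: G_def)
  also have "\<dots> = (\<integral>\<^sup>+P. emeasure N P \<partial>count_space G)"
    using G N by (intro emeasure_Union_disjoint) auto
  also have "\<dots> \<le> (\<integral>\<^sup>+P. b * emeasure M P \<partial>count_space G)"
    by (intro nn_integral_mono) (auto simp: G_def heavy_def not_less)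
  also have "\<dots> = b * emeasure M (\<Union>G)"
    using emeasure_Union_disjoint[OF G] by (simp add: nn_integral_cmult)
  also have "emeasure M (\<Union>G) \<le> emeasure M (qball \<rho> (xc i R) (?c * \<delta> powi i))"
  proof (rule emeasure_mono)
    show "\<Union>G \<subseteq> qball \<rho> (xc i R) (?c * \<delta> powi i)"
    proof
      fix y assume "y \<in> \<Union>G"
      then obtain P z where P: "P \<in> T i" "y \<in> P" "z \<in> P" "z \<in> R" by (auto simp: G_def)
      have "\<rho> (xc i R) z < C * \<delta> powi i" using S.cube_subset_qball[OF R] P(4) by (auto simp: qball_def)
      moreover have "\<rho> z y < C0 * (2 * C * \<delta> powi i)" by (rule T.rho_less_in_cube[OF P(1,3,2)])
      ultimately have "\<rho> (xc i R) z + \<rho> z y < (C + C0 * (2 * C)) * \<delta> powi i" by (simp add: algebra_simps)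
      then have "C0 * (\<rho> (xc i R) z + \<rho> z y) < ?c * \<delta> powi i"
        using T.C0_ge1 by (simp add: mult.assoc)
      then show "y \<in> qball \<rho> (xc i R) (?c * \<delta> powi i)"
        using T.rho_triangle[of "xc i R" y z] by (simp add: qball_def)
    qed
    show "qball \<rho> (xc i R) (?c * \<delta> powi i) \<in> sets M"
      using c_pos by (intro T.qball_sets mult_pos_pos[OF c_pos]) auto
  qed
  also have "\<dots> \<le> ennreal (Cd ^ m) * emeasure M R" by (rule S.emeasure_dilated_le[OF R m c_pos])
  finally show ?thesis by (simp add: mult_left_mono)
qed

text \<open>For \<open>R\<close> and \<open>R'\<close> in \<open>H x\<close>, the point
  \<open>x\<close> lies in a heavy cube of the generation of \<open>R'\<close>, which meets
  \<open>star R\<close> but cannot contain it. So \<open>generation_gap\<close> applies, and by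
  symmetry all generations fall in a window of \<open>2 * (p * k) + 1\<close> integers. Each is
  attained once, since cubes of \<open>S\<close> of one generation through \<open>x\<close>
  coincide.\<close>

lemma light_overlap_le:
  fixes N :: "'a measure" and b :: ennreal and Q2 :: "'a set"
  assumes p: "2 * max (D * C) 1 < (1 / \<delta>) ^ p"
  defines "H x \<equiv> {R \<in> light_family N b Q2. x \<in> R \<inter> \<Union>(T (gen R) \<inter> heavy N b)}"
  shows "finite (H x) \<and> card (H x) \<le> (2 * p + 1) * k"
proof (cases "H x = {}")
  case False
  then obtain R1 where R1: "R1 \<in> H x" by blast
  have gap: "gen R < gen R' + int (p * k)" if R: "R \<in> H x" and R': "R' \<in> H x" for R R'
  proof -
    obtain P where P: "P \<in> T (gen R')" "P \<in> heavy N b" "x \<in> P" using R' by (auto simp: H_def)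
    have RS: "R \<in> S'" "x \<in> R" "\<not> star R \<subseteq> P" using R P by (auto simp: H_def light_family_def)
    then show ?thesis using generation_gap[OF p RS(1) P(1)] subset_star[OF RS(1)] P(3) by blast
  qed
  let ?I = "{gen R1 - int (p * k) .. gen R1 + int (p * k)}"
  have inj: "inj_on gen (H x)"
  proof (rule inj_onI)
    fix R R' assume "R \<in> H x" "R' \<in> H x" "gen R = gen R'"
    moreover from this have "R \<in> S'" "R' \<in> S'" "x \<in> R" "x \<in> R'"
      by (auto simp: H_def light_family_def)
    moreover from this have "R \<in> S (gen R)" "R' \<in> S (gen R')" by (auto intro: S'_gen)
    ultimately show "R = R'" using S.cubes_same_generation_eq[of R "gen R" R'] by auto
  qed
  have sub: "gen ` H x \<subseteq> ?I" using gap[OF R1] gap[OF _ R1] by force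
  have fin: "finite (H x)" using inj finite_subset[OF sub] finite_imageD by blast
  have "card (H x) = card (gen ` H x)" using inj by (simp add: card_image)
  also have "\<dots> \<le> card ?I" using sub by (intro card_mono) auto
  also have "\<dots> = 2 * (p * k) + 1" by (simp del: of_nat_mult)
  also have "\<dots> \<le> (2 * p + 1) * k" using k_ge1 by (simp add: algebra_simps)
  finally show ?thesis using fin by simp
qed simp

lemma light_mass_le:
  assumes N: "sets N = sets M" "absolutely_continuous M N" and Q2: "Q2 \<in> sets M"
    and m: "C0 * (C + C0 * (2 * C)) \<le> 2 ^ m" and p: "2 * max (D * C) 1 < (1 / \<delta>) ^ p"
  shows "(\<integral>\<^sup>+R. emeasure N R \<partial>count_space (light_family N b Q2))
    \<le> b * ennreal (Cd ^ m) * (2 * emeasure M Q2) + of_nat ((2 * p + 1) * k) * emeasure N UNIV"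
proof -
  let ?F = "light_family N b Q2"
  let ?H = "\<lambda>R. R \<inter> \<Union>(T (gen R) \<inter> heavy N b)"
  have F: "?F \<subseteq> S'" by (auto simp: light_family_def)
  have H_sets: "?H R \<in> sets M" if "R \<in> ?F" for R
  proof -
    have "R \<in> sets M" using S'_gen S.cube_sets F that by blast
    moreover have "\<Union>(T (gen R) \<inter> heavy N b) \<in> sets M"
      using heavy_sets countable_heavy by (intro sets.countable_Union) auto
    ultimately show ?thesis by blast
  qed
  have split: "emeasure N R \<le> b * ennreal (Cd ^ m) * emeasure M R + emeasure N (?H R)" if "R \<in> ?F" for R
  proof -
    let ?i = "gen R" let ?G = "R \<inter> \<Union>(T (gen R) - heavy N b)" let ?Z = "UNIV - \<Union>(T ?i)"
    have R: "R \<in> S ?i" using that F S'_gen by blast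
    \<comment> \<open>The cubes of one generation cover the space only up to an
      \<open>M\<close>-null set; absolute continuity makes this set negligible for \<open>N\<close>
      too.\<close>
    have Z: "?Z \<in> null_sets N"
      using T.null_compl N(2) by (auto simp: absolutely_continuous_def)
    have G_sets: "?G \<in> sets M"
      using S.cube_sets[OF R] T.cube_sets
      by (intro sets.Int sets.countable_Union) (auto intro: countable_subset[OF _ T.countable_generation])
    have "emeasure N R \<le> emeasure N ((?G \<union> ?H R) \<union> ?Z)"
      using G_sets H_sets[OF that] Z N by (intro emeasure_mono) auto
    also have "\<dots> = emeasure N (?G \<union> ?H R)"
      using Z G_sets H_sets[OF that] N(1) by (intro emeasure_Un_null_set) auto
    also have "\<dots> \<le> emeasure N ?G + emeasure N (?H R)"
      using G_sets H_sets[OF that] N(1) by (intro emeasure_subadditive) auto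
    also have "\<dots> \<le> b * ennreal (Cd ^ m) * emeasure M R + emeasure N (?H R)"
      using emeasure_light_part_le[OF N(1) R m] by (intro add_right_mono) (simp add: mult.assoc)
    finally show ?thesis .
  qed
  have "(\<integral>\<^sup>+R. emeasure N R \<partial>count_space ?F)
    \<le> (\<integral>\<^sup>+R. b * ennreal (Cd ^ m) * emeasure M R + emeasure N (?H R) \<partial>count_space ?F)"
    using split by (intro nn_integral_mono) auto
  also have "\<dots> = b * ennreal (Cd ^ m) * (\<integral>\<^sup>+R. emeasure M R \<partial>count_space ?F)
      + (\<integral>\<^sup>+R. emeasure N (?H R) \<partial>count_space ?F)"
    by (simp add: nn_integral_add nn_integral_cmult)
  also have "\<dots> \<le> b * ennreal (Cd ^ m) * (2 * emeasure M Q2) + of_nat ((2 * p + 1) * k) * emeasure N UNIV"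
  proof (intro add_mono mult_left_mono)
    show "(\<integral>\<^sup>+R. emeasure M R \<partial>count_space ?F) \<le> 2 * emeasure M Q2"
    proof (rule sparse_packing)
      show "R \<subseteq> Q2" if "R \<in> ?F" for R
        using that subset_star by (auto simp: light_family_def)
    qed (use F S'_subset Q2 in auto)
    have "space N = UNIV" using sets_eq_imp_space_eq[OF N(1)] T.space_M by simp
    then show "(\<integral>\<^sup>+R. emeasure N (?H R) \<partial>count_space ?F) \<le> of_nat ((2 * p + 1) * k) * emeasure N UNIV"
      using nn_integral_count_space_indicator_le[of ?F ?H "(2 * p + 1) * k" N]
        light_overlap_le[OF p] countable_subset[OF F countable_S'] H_sets N(1) by simp
  qed auto
  finally show ?thesis .
qed

end

subsection \<open>The median of the adjoint operator\<close>

context sparse_operator_setting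
begin

text \<open>Here \<open>a\<close> is any positive upper bound for the average of
  \<open>\<bar>f\<bar>\<close>, rather than the average itself, so that one may divide by it even
  when \<open>f\<close> vanishes on \<open>Q2\<close>.\<close>

lemma median_sparse_operator_adj_le:
  assumes Q2: "Q2 \<in> T i" "qdiam \<rho> Q2 > D * 2 ^ k * C * \<delta> powi gen Q0"
    and f: "f \<in> borel_measurable M"
    and a: "0 < a" "(\<integral>\<^sup>+x\<in>Q2. ennreal \<bar>f x\<bar> \<partial>M) \<le> ennreal a * emeasure M Q2"
    and m: "C0 * (C + C0 * (2 * C)) \<le> 2 ^ m" and p: "2 * max (D * C) 1 < (1 / \<delta>) ^ p"
  shows "\<bar>median_on M (sparse_operator_adj M S' star f) Q2\<bar>
    \<le> 8 * (16 * Cd ^ m + real (2 * p + 1)) * real k * a"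
proof -
  \<comment> \<open>The cut-off keeps the total mass at most \<open>a\<close> times the measure of
    \<open>Q2\<close>, and loses nothing on the light sets, which lie in \<open>Q2\<close>.\<close>
  define N where "N = density M (\<lambda>x. ennreal \<bar>f x\<bar> * indicator Q2 x)"
  define b where "b = ennreal (8 * a)"
  define A where "A = 16 * Cd ^ m + real (2 * p + 1)"
  \<comment> \<open>The factors 8 in \<open>b\<close> and \<open>t\<close> make each of the two
    exceptional sets, the heavy cubes and the Chebyshev set \<open>W\<close>, at most an eighth of
    \<open>Q2\<close>.\<close>
  define t where "t = 8 * A * real k * a"
  let ?F = "light_family N b Q2"
  let ?\<Omega> = "\<Union>(heavy N b)"
  \<comment> \<open>A pointwise majorant of the light part of the adjoint operator, written as a
    nonnegative extended sum so that convergence is no issue. Its integral is the sum of the masses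
    \<open>emeasure N R\<close>.\<close>
  define h where "h x = (\<integral>\<^sup>+R. ennreal (1 / measure M (star R)) * emeasure N R * indicator (star R) x \<partial>count_space ?F)" for x
  note Q2s = T.cube_sets[OF Q2(1)]
  note mQ2 = T.emeasure_cube_eq_measure[OF Q2(1)]
  have dens: "(\<lambda>x. ennreal \<bar>f x\<bar> * indicator Q2 x) \<in> borel_measurable M" using f Q2s by measurable
  have N: "sets N = sets M" "absolutely_continuous M N"
    using absolutely_continuousI_density[OF dens] by (simp_all add: N_def)
  have N_le: "emeasure N E \<le> ennreal (a * measure M Q2)" if "E \<in> sets M" for E
  proof -
    have "emeasure N E = (\<integral>\<^sup>+x. ennreal \<bar>f x\<bar> * indicator Q2 x * indicator E x \<partial>M)"
      unfolding N_def using dens that by (rule emeasure_density)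
    also have "\<dots> \<le> (\<integral>\<^sup>+x\<in>Q2. ennreal \<bar>f x\<bar> \<partial>M)"
      by (intro nn_integral_mono) (auto simp: indicator_def)
    finally show ?thesis using a mQ2 by (simp add: ennreal_mult)
  qed
  have UNIV_sets: "UNIV \<in> sets M" using sets.top[of M] T.space_M by simp
  have Cd0: "0 \<le> Cd ^ m" using T.Cd_ge1 by simp
  have A_pos: "0 < A" using Cd0 by (simp add: A_def add_nonneg_pos)
  have t_pos: "0 < t" using A_pos k_ge1 a(1) by (simp add: t_def)
  have q_pos: "0 < measure M Q2" by (rule T.measure_cube_pos[OF Q2(1)])
  have two: "2 * ennreal (measure M Q2) = ennreal (2 * measure M Q2)" by (simp add: ennreal_mult)
  have F: "?F \<subseteq> S'" by (auto simp: light_family_def)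
  have cF: "countable ?F" using countable_subset[OF F countable_S'] .
  have star_sets: "star R \<in> sets M" if "R \<in> S'" for R using star_cube[OF that] T.cube_sets by blast

  have \<Omega>_sets: "?\<Omega> \<in> sets M"
    using heavy_sets countable_heavy by (intro sets.countable_Union) auto
  have "b * emeasure M ?\<Omega> \<le> ennreal (a * measure M Q2)"
    using emeasure_heavy_Union_le[OF N(1)] N_le[OF \<Omega>_sets] by (rule order_trans)
  then have "ennreal (1 / (8 * a)) * (b * emeasure M ?\<Omega>) \<le> ennreal (1 / (8 * a)) * ennreal (a * measure M Q2)"
    by (rule mult_left_mono) simp
  then have \<Omega>_le: "emeasure M ?\<Omega> \<le> ennreal (measure M Q2 / 8)"
    using a(1) by (simp add: b_def mult.assoc[symmetric] ennreal_mult[symmetric])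

  have h_meas: "h \<in> borel_measurable M"
    unfolding h_def using cF F star_sets by (intro borel_measurable_nn_integral_count_space) auto
  have "(\<integral>\<^sup>+x. h x \<partial>M) = (\<integral>\<^sup>+R. \<integral>\<^sup>+x. ennreal (1 / measure M (star R)) * emeasure N R * indicator (star R) x \<partial>M \<partial>count_space ?F)"
    unfolding h_def using cF F star_sets by (intro nn_integral_count_space_nn_integral) auto
  also have "\<dots> = (\<integral>\<^sup>+R. emeasure N R \<partial>count_space ?F)"
  proof (rule nn_integral_cong)
    fix R assume "R \<in> space (count_space ?F)"
    then have R: "R \<in> S'" using F by auto
    obtain j where j: "star R \<in> T j" using star_cube[OF R] by blast
    have "(\<integral>\<^sup>+x. ennreal (1 / measure M (star R)) * emeasure N R * indicator (star R) x \<partial>M)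
      = ennreal (1 / measure M (star R)) * emeasure N R * ennreal (measure M (star R))"
      using star_sets[OF R] T.emeasure_cube_eq_measure[OF j] by (simp add: nn_integral_cmult)
    also have "\<dots> = emeasure N R * (ennreal (1 / measure M (star R)) * ennreal (measure M (star R)))"
      by (simp only: mult_ac)
    also have "\<dots> = emeasure N R"
      using T.measure_cube_pos[OF j] by (simp flip: ennreal_mult)
    finally show "(\<integral>\<^sup>+x. ennreal (1 / measure M (star R)) * emeasure N R * indicator (star R) x \<partial>M) = emeasure N R" .
  qed
  also have "\<dots> \<le> b * ennreal (Cd ^ m) * (2 * emeasure M Q2) + of_nat ((2 * p + 1) * k) * emeasure N UNIV"
    by (rule light_mass_le[OF N Q2s m p])
  also have "\<dots> \<le> b * ennreal (Cd ^ m) * (2 * emeasure M Q2) + ennreal (real ((2 * p + 1) * k)) * ennreal (a * measure M Q2)"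
    unfolding ennreal_of_nat_eq_real_of_nat
    by (intro add_left_mono mult_left_mono N_le[OF UNIV_sets]) simp
  also have "\<dots> = ennreal (8 * a * Cd ^ m * (2 * measure M Q2) + real ((2 * p + 1) * k) * (a * measure M Q2))"
    unfolding b_def mQ2 two using a(1) Cd0 q_pos
    by (simp add: ennreal_mult[symmetric] ennreal_plus[symmetric] del: ennreal_plus of_nat_mult)
  also have "\<dots> \<le> ennreal (A * k * a * measure M Q2)"
  proof (rule ennreal_leI)
    \<comment> \<open>The sparse-packing term carries no factor \<open>k\<close>;
      \<open>1 \<le> k\<close> lets it be merged with the overlap term.\<close>
    have "16 * Cd ^ m * (a * measure M Q2) * 1 \<le> 16 * Cd ^ m * (a * measure M Q2) * real k"
      using Cd0 a(1) q_pos k_ge1 by (intro mult_left_mono) auto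
    then show "8 * a * Cd ^ m * (2 * measure M Q2) + real ((2 * p + 1) * k) * (a * measure M Q2) \<le> A * k * a * measure M Q2"
      by (simp add: A_def algebra_simps)
  qed
  finally have h_int: "(\<integral>\<^sup>+x. h x \<partial>M) \<le> ennreal (t * (measure M Q2 / 8))" by (simp add: t_def mult.assoc)
  define W where "W = {x \<in> space M. ennreal t < h x}"
  have W_sets: "W \<in> sets M" unfolding W_def using h_meas by measurable
  have "ennreal t * emeasure M W = (\<integral>\<^sup>+x. ennreal t * indicator W x \<partial>M)"
    using W_sets by (simp add: nn_integral_cmult)
  also have "\<dots> \<le> (\<integral>\<^sup>+x. h x \<partial>M)"
    by (intro nn_integral_mono) (auto simp: W_def indicator_def intro: less_imp_le)
  also note h_int
  finally have "ennreal (1 / t) * (ennreal t * emeasure M W) \<le> ennreal (1 / t) * ennreal (t * (measure M Q2 / 8))"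
    by (rule mult_left_mono) simp
  then have W_le: "emeasure M W \<le> ennreal (measure M Q2 / 8)"
    using t_pos by (simp add: mult.assoc[symmetric] ennreal_mult[symmetric])

  let ?g = "sparse_operator_adj M S' star f"
  have g_meas: "?g \<in> borel_measurable M"
    unfolding sparse_operator_adj_def using countable_S' star_sets
    by (intro borel_measurable_infsum_countable) auto
  have g_le: "\<bar>?g x\<bar> \<le> t" if x: "x \<in> Q2" "x \<notin> ?\<Omega>" "x \<notin> W" for x
  proof -
    let ?c = "\<lambda>R. (1 / measure M (star R) * (LINT y:R|M. f y)) * indicator (star R) x"
    \<comment> \<open>The cube \<open>star R\<close> meets \<open>Q2\<close>, hence lies in it, and
      a heavy cube containing \<open>star R\<close> would contain \<open>x\<close>.\<close>
    have inF: "R \<in> ?F" if R: "R \<in> S'" "x \<in> star R" for R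
      using star_subset[OF R(1) Q2] x R by (auto simp: light_family_def)
    have c_le: "ennreal \<bar>?c R\<bar> \<le> ennreal (1 / measure M (star R)) * emeasure N R * indicator (star R) x"
      if "R \<in> ?F" for R
    proof -
      have R: "R \<subseteq> Q2" "R \<in> sets M"
        using that subset_star[of R] S.cube_sets[OF S'_gen[of R]] by (auto simp: light_family_def)
      have "ennreal \<bar>LINT y:R|M. f y\<bar> \<le> (\<integral>\<^sup>+y. ennreal \<bar>indicator R y *\<^sub>R f y\<bar> \<partial>M)"
        unfolding set_lebesgue_integral_def by (rule ennreal_abs_integral_le)
      also have "\<dots> = (\<integral>\<^sup>+y. ennreal \<bar>f y\<bar> * indicator Q2 y * indicator R y \<partial>M)"
        using R(1) by (intro nn_integral_cong) (auto simp: indicator_def)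
      also have "\<dots> = emeasure N R"
        unfolding N_def using dens R(2) by (rule emeasure_density[symmetric])
      finally have "ennreal (1 / measure M (star R)) * ennreal \<bar>LINT y:R|M. f y\<bar>
        \<le> ennreal (1 / measure M (star R)) * emeasure N R" by (rule mult_left_mono) simp
      then show ?thesis
        by (auto simp: indicator_def abs_mult ennreal_mult[symmetric])
    qed
    have "(\<integral>\<^sup>+R. ennreal \<bar>?c R\<bar> \<partial>count_space S') = (\<integral>\<^sup>+R. ennreal \<bar>?c R\<bar> \<partial>count_space ?F)"
      using F inF by (intro nn_integral_count_space_eq) (auto simp: indicator_def)
    also have "\<dots> \<le> h x" unfolding h_def using c_le by (intro nn_integral_mono) simp
    also have "\<dots> \<le> ennreal t" using x(3) T.space_M by (simp add: W_def not_less)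
    finally show ?thesis unfolding sparse_operator_adj_def
      using t_pos by (intro abs_infsum_le_nn_integral) auto
  qed
  \<comment> \<open>The set of large values lies in the two exceptional sets, hence has at most a
    quarter of the measure of \<open>Q2\<close>: strictly less than half, as the median bound
    requires.\<close>
  have "emeasure M {x \<in> Q2. \<bar>?g x\<bar> > t} \<le> emeasure M (?\<Omega> \<union> W)"
    using g_le \<Omega>_sets W_sets by (intro emeasure_mono) (auto simp: not_le[symmetric])
  also have "\<dots> \<le> emeasure M ?\<Omega> + emeasure M W"
    using \<Omega>_sets W_sets by (intro emeasure_subadditive)
  also have "\<dots> \<le> ennreal (measure M Q2 / 8) + ennreal (measure M Q2 / 8)"
    by (intro add_mono \<Omega>_le W_le)
  also have "\<dots> = ennreal (measure M Q2 / 4)"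
    using q_pos by (simp add: ennreal_plus[symmetric] del: ennreal_plus)
  finally have "measure M {x \<in> Q2. \<bar>?g x\<bar> > t} \<le> measure M Q2 / 4"
    unfolding measure_def[of M "{x \<in> Q2. \<bar>?g x\<bar> > t}"] using q_pos by (intro enn2real_leI) auto
  then have "\<bar>median_on M ?g Q2\<bar> \<le> t"
    using Q2s T.emeasure_cube_finite[OF Q2(1)] g_meas q_pos by (intro abs_median_on_le) auto
  then show ?thesis by (simp add: t_def A_def)
qed

end

subsection \<open>Weighted estimate\<close>

context doubling_space
begin

lemma A2_const_ball_le:
  assumes "0 < r"
  shows "((\<integral>\<^sup>+y\<in>qball \<rho> x r. ennreal (\<omega> y) \<partial>M) / emeasure M (qball \<rho> x r)) *
     ((\<integral>\<^sup>+y\<in>qball \<rho> x r. inverse (ennreal (\<omega> y)) \<partial>M) / emeasure M (qball \<rho> x r)) \<le> A2_const M \<rho> \<omega>"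
  unfolding A2_const_def using assms by (intro SUP_upper2[of x] SUP_upper2[of r]) auto

text \<open>The \<open>A2\<close> condition concerns balls, so \<open>Q\<close> is compared with a
  ball around it at the cost of \<open>L\<close>. The bound on \<open>c\<close> is assumed for every
  positive upper bound \<open>a\<close> of the average, matching the preceding median
  estimate.\<close>

lemma L2_norm_const_le_A2:
  assumes A2: "A2_weight M \<rho> \<omega>" and f: "f \<in> L2_weighted M \<omega>"
    and Q: "Q \<in> sets M" "Q \<subseteq> qball \<rho> x r" "0 < measure M Q" and r: "0 < r"
    and L: "measure M (qball \<rho> x r) \<le> L * measure M Q" and K: "0 \<le> K"
    and c: "\<And>a. 0 < a \<Longrightarrow> (\<integral>\<^sup>+x\<in>Q. ennreal \<bar>f x\<bar> \<partial>M) \<le> ennreal a * emeasure M Q \<Longrightarrow> \<bar>c\<bar> \<le> K * a"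
  shows "L2_norm_on M \<omega> Q (\<lambda>x. c) \<le> K * L * L2_norm_on M \<omega> Q f * enn2real (A2_const M \<rho> \<omega>)"
proof -
  let ?B = "qball \<rho> x r"
  define q where "q = measure M Q"
  define s where "s = measure M ?B"
  define W where "W = enn2real (A2_const M \<rho> \<omega>)"
  define F where "F = (LINT x:Q|M. \<bar>f x\<bar>\<^sup>2 * \<omega> x)"
  define w where "w = (LINT x:?B|M. \<omega> x)"
  define wQ where "wQ = (LINT x:Q|M. \<omega> x)"
  have \<omega>: "\<omega> \<in> borel_measurable M" "\<And>x. 0 \<le> \<omega> x" "set_integrable M ?B \<omega>"
    using A2 r by (auto simp: A2_weight_def weight_def)
  have W: "A2_const M \<rho> \<omega> = ennreal W" using A2 by (simp add: A2_weight_def W_def)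
  have W0: "0 \<le> W" by (simp add: W_def)
  have fm: "f \<in> borel_measurable M" "integrable M (\<lambda>x. \<bar>f x\<bar>\<^sup>2 * \<omega> x)" using f by (auto simp: L2_weighted_def)
  have fQ: "set_integrable M Q (\<lambda>x. \<bar>f x\<bar>\<^sup>2 * \<omega> x)"
    using fm(2) Q(1) unfolding set_integrable_def by (intro integrable_mult_indicator) auto
  have F: "(\<integral>\<^sup>+x\<in>Q. ennreal (\<bar>f x\<bar>\<^sup>2 * \<omega> x) \<partial>M) = ennreal F"
    unfolding F_def using \<omega>(2) by (intro set_nn_integral_eq_set_integral fQ) auto
  have F0: "0 \<le> F" unfolding F_def set_lebesgue_integral_def using \<omega>(2) by (intro integral_nonneg_AE) auto
  have Bs: "?B \<in> sets M" using qball_sets[OF r] .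
  have \<omega>Q: "set_integrable M Q \<omega>" using set_integrable_subset[OF \<omega>(3) Q(1,2)] .
  have w: "(\<integral>\<^sup>+x\<in>?B. ennreal (\<omega> x) \<partial>M) = ennreal w"
    unfolding w_def using \<omega> by (intro set_nn_integral_eq_set_integral) auto
  have wQ: "(\<integral>\<^sup>+x\<in>Q. ennreal (\<omega> x) \<partial>M) = ennreal wQ"
    unfolding wQ_def using \<omega> \<omega>Q by (intro set_nn_integral_eq_set_integral) auto
  have w0: "0 \<le> w" "0 \<le> wQ" unfolding w_def wQ_def set_lebesgue_integral_def
    using \<omega>(2) by (auto intro!: integral_nonneg_AE)
  have "ennreal wQ \<le> ennreal w"
    unfolding w[symmetric] wQ[symmetric] using Q(2) by (intro nn_integral_mono) (auto simp: indicator_def)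
  then have wQ_le: "wQ \<le> w" using w0 by simp
  have sB: "emeasure M ?B = ennreal s"
    unfolding s_def using qball_finite[OF r] by (metis emeasure_eq_ennreal_measure infinity_ennreal_def less_irrefl)
  have qQ: "emeasure M Q = ennreal q"
    unfolding q_def using Q(3) by (metis emeasure_eq_ennreal_measure less_irrefl measure_def enn2real_top)
  have s_pos: "0 < s" using qball_pos[OF r, of x] sB by simp
  have q_pos: "0 < q" using Q(3) by (simp add: q_def)
  have lhs: "L2_norm_on M \<omega> Q (\<lambda>x. c) = sqrt (c\<^sup>2 * wQ)"
    by (simp add: L2_norm_on_def wQ_def)
  have rhs: "L2_norm_on M \<omega> Q f = sqrt F" by (simp add: L2_norm_on_def F_def)
  have L0: "0 \<le> L" using L s_pos q_pos unfolding s_def[symmetric] q_def[symmetric]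
    by (meson less_le_trans less_imp_le zero_less_mult_pos2)
  show ?thesis
  proof (cases "w = 0")
    \<comment> \<open>If the weight has no mass on the ball, the left side is 0. The case is
      separate because \<open>0 * \<infinity> = 0\<close> in \<open>ennreal\<close>, so the finite
      \<open>A2\<close> constant would not bound the reciprocal integral.\<close>
    case True
    then have "wQ = 0" using wQ_le w0 by simp
    then show ?thesis unfolding lhs rhs W_def[symmetric] using K L0 F0 W0 by simp
  next
    case False
    then have w_pos: "0 < w" using w0 by simp
    let ?V = "\<integral>\<^sup>+y\<in>?B. inverse (ennreal (\<omega> y)) \<partial>M"
    have prod: "(ennreal w / ennreal s) * (?V / ennreal s) \<le> ennreal W"
      using A2_const_ball_le[OF r, where x = x and \<omega> = \<omega>] unfolding w sB W .
    have V_fin: "?V < \<infinity>"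
    proof (rule ccontr)
      assume "\<not> ?V < \<infinity>"
      then have "?V = \<infinity>" by (simp add: not_less top_unique)
      then have "(ennreal w / ennreal s) * (?V / ennreal s) = \<infinity>"
        using w_pos s_pos by (simp add: divide_ennreal ennreal_top_divide ennreal_mult_top)
      then show False using prod by (simp add: top_unique)
    qed
    then obtain v where v: "?V = ennreal v" "0 \<le> v" by (cases ?V) auto
    have wv: "w * v \<le> W * s\<^sup>2"
    proof -
      have "ennreal (w / s * (v / s)) \<le> ennreal W"
        using prod v w_pos s_pos by (simp add: divide_ennreal ennreal_mult[symmetric])
      then have "w / s * (v / s) \<le> W" using W0 by simp
      then show ?thesis using s_pos by (simp add: field_simps power2_eq_square)
    qed
    \<comment> \<open>Cauchy-Schwarz for the constant function 1 on the ball shows that the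
      \<open>A2\<close> constant is at least 1.\<close>
    have "(\<integral>\<^sup>+x\<in>?B. ennreal \<bar>1::real\<bar> \<partial>M)\<^sup>2 \<le> (\<integral>\<^sup>+x\<in>?B. ennreal (\<bar>1\<bar>\<^sup>2 * \<omega> x) \<partial>M) * ?V"
      using \<omega> Bs V_fin by (intro Cauchy_Schwarz_weight) auto
    then have "ennreal (s\<^sup>2) \<le> ennreal (w * v)"
      using Bs sB w v w0 s_pos by (simp add: ennreal_power ennreal_mult)
    then have sv: "s\<^sup>2 \<le> w * v" using w_pos v(2) by simp
    have W1: "1 \<le> W"
    proof -
      have "1 * s\<^sup>2 \<le> W * s\<^sup>2" using sv wv by simp
      then show ?thesis using s_pos by simp
    qed
    have VQ: "(\<integral>\<^sup>+x\<in>Q. inverse (ennreal (\<omega> x)) \<partial>M) \<le> ?V"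
      using Q(2) by (intro nn_integral_mono) (auto simp: indicator_def)
    have "(\<integral>\<^sup>+x\<in>Q. ennreal \<bar>f x\<bar> \<partial>M)\<^sup>2
      \<le> (\<integral>\<^sup>+x\<in>Q. ennreal (\<bar>f x\<bar>\<^sup>2 * \<omega> x) \<partial>M) * (\<integral>\<^sup>+x\<in>Q. inverse (ennreal (\<omega> x)) \<partial>M)"
      using \<omega> fm(1) Q(1) V_fin VQ by (intro Cauchy_Schwarz_weight) auto
    also have "\<dots> \<le> ennreal F * ennreal v"
      unfolding F using VQ v by (intro mult_left_mono) auto
    finally have phi_sq: "(\<integral>\<^sup>+x\<in>Q. ennreal \<bar>f x\<bar> \<partial>M)\<^sup>2 \<le> ennreal (F * v)" using F0 v by (simp add: ennreal_mult)
    then have "(\<integral>\<^sup>+x\<in>Q. ennreal \<bar>f x\<bar> \<partial>M) \<noteq> \<infinity>"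
      by (auto simp: top_unique power2_eq_square)
    then obtain \<phi> where \<phi>: "(\<integral>\<^sup>+x\<in>Q. ennreal \<bar>f x\<bar> \<partial>M) = ennreal \<phi>" "0 \<le> \<phi>"
      by (cases "\<integral>\<^sup>+x\<in>Q. ennreal \<bar>f x\<bar> \<partial>M") auto
    have \<phi>F: "\<phi>\<^sup>2 \<le> F * v" using phi_sq \<phi> F0 v(2) by (simp add: ennreal_power)
    have "\<bar>c\<bar> \<le> K * (\<phi> / q) + e" if e: "0 < e" for e
    proof -
      \<comment> \<open>The extra term keeps \<open>?a\<close> positive when the average is 0;
        dividing by \<open>K + 1\<close> makes its contribution at most \<open>e\<close>, also for
        \<open>K = 0\<close>.\<close>
      let ?a = "\<phi> / q + e / (K + 1)"
      have a: "0 < ?a" using e K \<phi>(2) q_pos by (intro add_nonneg_pos) auto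
      have "?a * q = \<phi> + e / (K + 1) * q" using q_pos by (simp add: distrib_right)
      then have "\<phi> \<le> ?a * q" using e K q_pos by simp
      then have "\<bar>c\<bar> \<le> K * ?a"
        using a q_pos by (intro c) (auto simp: \<phi> qQ ennreal_mult[symmetric] intro!: ennreal_leI)
      moreover have "K * (e / (K + 1)) \<le> e" using e K by (simp add: field_simps)
      then have "K * ?a \<le> K * (\<phi> / q) + e" by (simp only: distrib_left add_left_mono)
      ultimately show ?thesis by linarith
    qed
    then have cK: "\<bar>c\<bar> \<le> K * (\<phi> / q)" by (rule field_le_epsilon)
    have "c\<^sup>2 * wQ \<le> (K * (\<phi> / q))\<^sup>2 * w"
      using power_mono[OF cK abs_ge_zero, of 2] wQ_le w0 by (intro mult_mono) auto
    also have "\<dots> = (K / q)\<^sup>2 * \<phi>\<^sup>2 * w" by (simp add: power_mult_distrib power_divide)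
    also have "\<dots> \<le> (K / q)\<^sup>2 * (F * v) * w"
      using \<phi>F w0 by (intro mult_right_mono mult_left_mono) auto
    also have "\<dots> = (K / q)\<^sup>2 * F * (w * v)" by simp
    also have "\<dots> \<le> (K / q)\<^sup>2 * F * (W * s\<^sup>2)"
      using wv F0 by (intro mult_left_mono) auto
    \<comment> \<open>The argument yields the square root of the \<open>A2\<close> constant;
      \<open>1 \<le> W\<close> weakens it to the linear bound, and \<open>s \<le> L * q\<close>
      passes from the ball back to \<open>Q\<close>.\<close>
    also have "\<dots> \<le> (K / q)\<^sup>2 * F * (W\<^sup>2 * (L * q)\<^sup>2)"
      using W1 L s_pos F0 unfolding s_def[symmetric] q_def[symmetric]
      by (intro mult_left_mono mult_mono power_mono) (auto simp: self_le_power)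
    also have "\<dots> = (K * L * sqrt F * W)\<^sup>2" using q_pos F0 by (simp add: power_mult_distrib power_divide)
    finally have "sqrt (c\<^sup>2 * wQ) \<le> K * L * sqrt F * W"
      using K L0 F0 W0 by (intro real_le_lsqrt) auto
    then show ?thesis unfolding lhs rhs W_def[symmetric] .
  qed
qed

end

theorem lemma6p17:
  fixes M :: "'a measure" and \<rho> :: "'a \<Rightarrow> 'a \<Rightarrow> real"
    and C \<delta> \<epsilon> D :: real and J :: nat
  assumes "homogeneous_space M \<rho>"
    and "C > 0" and "0 < \<delta>" and "\<delta> < 1" and "0 < \<epsilon>" and "\<epsilon> < 1" and "D > 0"
  shows "\<exists>\<beta>::real. \<forall>\<S> xcs. adjacent_dyadic_systems M \<rho> C \<delta> \<epsilon> J D \<S> xcs \<longrightarrow>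
    (\<forall>j\<in>{1..J}. \<forall>k\<ge>1. \<forall>S xc gen Q0 SQ S' star.
       sparse_operator_data M \<rho> C \<delta> \<epsilon> D (\<S> j) k S xc gen Q0 SQ S' star \<longrightarrow>
       (\<forall>\<omega> f. A2_weight M \<rho> \<omega> \<longrightarrow> f \<in> L2_weighted M \<omega> \<longrightarrow>
          (\<forall>Q2\<in>(\<Union>i. \<S> j i). qdiam \<rho> Q2 > D * 2 ^ k * C * \<delta> powi gen Q0 \<longrightarrow>
             L2_norm_on M \<omega> Q2 (\<lambda>x. median_on M (sparse_operator_adj M S' star f) Q2)
               \<le> \<beta> * real k * L2_norm_on M \<omega> Q2 f * enn2real (A2_const M \<rho> \<omega>))))"
proof -
  obtain C0 Cd where "doubling_space M \<rho> C0 Cd"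
    using homogeneous_space_imp_doubling_space[OF assms(1)] .
  then interpret doubling_space M \<rho> C0 Cd .
  \<comment> \<open>Both \<open>m\<close> and \<open>p\<close> are chosen from \<open>C0\<close>,
    \<open>C\<close>, \<open>D\<close> and \<open>\<delta>\<close> alone, before any dyadic system
    is fixed, so the resulting constant is uniform in all later data.\<close>
  obtain m :: nat where m: "C0 * (C + C0 * (2 * C)) \<le> 2 ^ m"
    using real_arch_pow[of 2 "C0 * (C + C0 * (2 * C))"] by (auto intro: less_imp_le)
  obtain p :: nat where p: "2 * max (D * C) 1 < (1 / \<delta>) ^ p"
    using real_arch_pow[of "1 / \<delta>" "2 * max (D * C) 1"] assms(3,4) by auto
  \<comment> \<open>The same \<open>m\<close> also controls the ball of radius
    \<open>C * \<delta> powi i\<close> around \<open>Q2\<close>, which yields the additional factor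
    \<open>Cd ^ m\<close> in the final constant.\<close>
  have Cm: "C \<le> 2 ^ m"
  proof -
    have "0 \<le> C0 * (2 * C)" using C0_ge1 assms(2) by simp
    then have "1 * C \<le> C0 * (C + C0 * (2 * C))"
      using C0_ge1 assms(2) by (intro mult_mono) auto
    then show ?thesis using m by simp
  qed
  define A where "A = 8 * (16 * Cd ^ m + real (2 * p + 1))"
  have A0: "0 \<le> A" using Cd_ge1 by (simp add: A_def)
  show ?thesis
  proof (intro exI[of _ "A * Cd ^ m"] allI ballI impI)
    fix \<S> xcs j k S xc gen Q0 SQ S' star \<omega> f Q2
    assume adj: "adjacent_dyadic_systems M \<rho> C \<delta> \<epsilon> J D \<S> xcs" and j: "j \<in> {1..J}" and k: "1 \<le> (k::nat)"
      and data: "sparse_operator_data M \<rho> C \<delta> \<epsilon> D (\<S> j) k S xc gen Q0 SQ S' star"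
      and \<omega>: "A2_weight M \<rho> \<omega>" and f: "f \<in> L2_weighted M \<omega>"
      and "Q2 \<in> (\<Union>i. \<S> j i)" and diam: "qdiam \<rho> Q2 > D * 2 ^ k * C * \<delta> powi gen Q0"
    then obtain i where i: "Q2 \<in> \<S> j i" by blast
    interpret sparse_operator_setting M \<rho> C0 Cd C \<delta> \<epsilon> "\<S> j" "xcs j" S xc D k gen Q0 SQ S' star
      using assms adj j k data
      by unfold_locales (auto simp: adjacent_dyadic_systems_def sparse_operator_data_def)
    let ?r = "C * \<delta> powi i"
    have r: "0 < ?r" using assms(2) by simp
    have "emeasure M (qball \<rho> (xcs j i Q2) ?r) \<le> ennreal (Cd ^ m) * emeasure M Q2"
      by (rule T.emeasure_dilated_le[OF i Cm assms(2)])
    also have "\<dots> = ennreal (Cd ^ m * measure M Q2)"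
      using Cd_ge1 T.emeasure_cube_eq_measure[OF i] by (simp add: ennreal_mult)
    finally have L: "measure M (qball \<rho> (xcs j i Q2) ?r) \<le> Cd ^ m * measure M Q2"
      unfolding measure_def[of M "qball \<rho> (xcs j i Q2) ?r"] using Cd_ge1 by (intro enn2real_leI) auto
    have "L2_norm_on M \<omega> Q2 (\<lambda>x. median_on M (sparse_operator_adj M S' star f) Q2)
      \<le> (A * real k) * Cd ^ m * L2_norm_on M \<omega> Q2 f * enn2real (A2_const M \<rho> \<omega>)"
    proof (rule L2_norm_const_le_A2[OF \<omega> f T.cube_sets[OF i] T.cube_subset_qball[OF i] T.measure_cube_pos[OF i] r L])
      show "0 \<le> A * real k" using A0 by simp
      fix a :: real assume "0 < a" "(\<integral>\<^sup>+x\<in>Q2. ennreal \<bar>f x\<bar> \<partial>M) \<le> ennreal a * emeasure M Q2"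
      then show "\<bar>median_on M (sparse_operator_adj M S' star f) Q2\<bar> \<le> A * real k * a"
        unfolding A_def using median_sparse_operator_adj_le[OF i diam _ _ _ m p] f
        by (auto simp: L2_weighted_def)
    qed
    then show "L2_norm_on M \<omega> Q2 (\<lambda>x. median_on M (sparse_operator_adj M S' star f) Q2)
      \<le> A * Cd ^ m * real k * L2_norm_on M \<omega> Q2 f * enn2real (A2_const M \<rho> \<omega>)"
      by (simp only: mult_ac)
  qed
qed

end
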